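(* Let $E$ be a real Fréchet space with an unconditional Schauder basis $\{e_k\}_{k\in\mathbb{N}}$ and the associated partial order $\ll$, let $T>0$, $I_T=[0,T]$, $\hat x\in E$, and let $f:I_T\times E\to E$, $f(t,x)=\sum_{k=1}^\infty f_k(t,x)e_k$, satisfy: (i) for every $k\in\mathbb{N}$ and every fixed $t\in I_T$ the function $f_k(t,\cdot):E\to\mathbb{R}$ is left continuous; (ii) for every fixed $x\in E$ the function $t\mapsto f(t,x)$ is integrable on $I_T$; (iii) there exists $C\in E$ such that $f(t,x)\ll C$ for all $(t,x)\in I_T\times E$; (iv) there exists $x_*\in E$ such that $x_*\ll \hat x+\int_0^t f(\xi,x_* )\,d\xi$ for all $t\in I_T$; (v) $f$ is monotone: for all $x,y\in E$ and all $t\in I_T$, $x\ll y$ implies $f(t,x)\ll f(t,y)$. Let $Q\subset C(I_T,E)$ be the (nonempty) set of all solutions of the initial value problem $\dot x(t)=f(t,x(t))$, $x(0)=\hat x$, and for $t\in I_T$ put $Q(t)=\{v(t)\mid v\in Q\}\subset E$. Then for each $t\in I_T$ the element $\overline x(t)=\sup Q(t)\in E$ is well defined, and the function $\overline x$ is a solution of the same initial value problem.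
   Context: The topology of the Fréchet space $E$ (Hausdorff, complete) is defined by a countable family of seminorms $\{\|\cdot\|_n\}_{n\in\mathbb{N}}$. A sequence $\{e_k\}_{k\in\mathbb{N}}\subset E$ is a Schauder basis if for every $x\in E$ there is a unique sequence of scalars $\{x_k\}$ with $x=\sum_{k=1}^\infty x_ke_k$ (convergence in the topology of $E$). It is unconditional if for every $x\in E$ and every permutation $\pi:\mathbb{N}\to\mathbb{N}$ the series $\sum_k x_{\pi(k)}e_{\pi(k)}$ converges to the same element $x$. The coordinate functionals are $e^j(x)=x_j$. Partial order: for $x=\sum x_ke_k$, $y=\sum y_ke_k$ in $E$, $x\ll y$ means $x_i\le y_i$ for all $i\in\mathbb{N}$. For a nonempty set $V\subset E$ one formally puts $\sup V:=\sum_{k=1}^\infty v_k^*e_k$ with $v_k^*=\sup\{e^k(v)\mid v\in V\}$; it is "well defined" as an element of $E$ if all $v_k^*$ are finite and the series converges in $E$. A function $g:E\to\mathbb{R}$ is left continuous if for every $x'\in E$ and every sequence $x_k\to x'$ in $E$ with $x_k\ll x_{k+1}$ for all $k\in\mathbb{N}$, one has $\lim_{k\to\infty}g(x_k)=g(x')$. Integrability: $I_T$ carries Lebesgue measure $\mu$. A step function $h:I_T\to E$ is a function with finitely many values $a_1,\dots,a_\nu$, each level set $A_k=h^{-1}(a_k)$ being measurable; its integral is $\sum_{a_k\neq0}a_k\mu(A_k)$. A function $g:I_T\to E$ is integrable if there is a sequence of step functions $h_n$ with $h_n\to g$ almost everywhere and, for every $s\in\mathbb{N}$, $\int\|h_n-h_m\|_s\to0$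 as $n,m\to\infty$; then $\int g:=\lim_n\int h_n$ (limit in $E$, independent of the choice of $h_n$). Solution: a function $x\in C(I_T,E)$ is a solution of the initial value problem if $t\mapsto f(t,x(t))$ is integrable on $I_T$ and $x(t)=\hat x+\int_0^t f(\xi,x(\xi))\,d\xi$ for all $t\in I_T$. *)

theory Defs
  imports "HOL-Analysis.Analysis"
begin

section \<open>Frechet spaces\<close>

definition seminorm :: "('a::real_vector \<Rightarrow> real) \<Rightarrow> bool" where
  "seminorm q \<longleftrightarrow>
     (\<forall>x y. q (x + y) \<le> q x + q y) \<and> (\<forall>r x. q (r *\<^sub>R x) = \<bar>r\<bar> * q x)"

text \<open>
  The topology is the one of the type class, so that library notions of limit, series and
  continuity apply; the Hausdorff property is part of \<^class>\<open>t2_space\<close>. The space being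
  metrizable, completeness is completeness for Cauchy sequences.
\<close>

locale frechet_space =
  fixes p :: "nat \<Rightarrow> 'a::{real_vector, t2_space} \<Rightarrow> real"
  assumes seminorm: "seminorm (p n)"
    and open_iff: "open U \<longleftrightarrow> (\<forall>x\<in>U. \<exists>n. \<exists>\<epsilon>>0. {y. \<forall>i\<le>n. p i (y - x) < \<epsilon>} \<subseteq> U)"
    and complete:
      "(\<And>s. \<forall>\<epsilon>>0. \<exists>N. \<forall>m\<ge>N. \<forall>n\<ge>N. p s (X m - X n) < \<epsilon>) \<Longrightarrow> \<exists>l. X \<longlonglongrightarrow> l"


section \<open>Schauder bases and the associated order\<close>

definition schauder_basis :: "(nat \<Rightarrow> 'a::{real_vector, t2_space}) \<Rightarrow> bool" where
  "schauder_basis e \<longleftrightarrow> (\<forall>x. \<exists>!c. (\<lambda>k. c k *\<^sub>R e k) sums x)"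

definition coord :: "(nat \<Rightarrow> 'a::{real_vector, t2_space}) \<Rightarrow> nat \<Rightarrow> 'a \<Rightarrow> real" where
  "coord e j x = (THE c. (\<lambda>k. c k *\<^sub>R e k) sums x) j"

definition unconditional_schauder_basis :: "(nat \<Rightarrow> 'a::{real_vector, t2_space}) \<Rightarrow> bool" where
  "unconditional_schauder_basis e \<longleftrightarrow>
     schauder_basis e \<and>
     (\<forall>x \<pi>. bij \<pi> \<longrightarrow> (\<lambda>k. coord e (\<pi> k) x *\<^sub>R e (\<pi> k)) sums x)"

definition coord_le :: "(nat \<Rightarrow> 'a::{real_vector, t2_space}) \<Rightarrow> 'a \<Rightarrow> 'a \<Rightarrow> bool" where
  "coord_le e x y \<longleftrightarrow> (\<forall>i. coord e i x \<le> coord e i y)"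

definition coord_sup_well_defined :: "(nat \<Rightarrow> 'a::{real_vector, t2_space}) \<Rightarrow> 'a set \<Rightarrow> bool" where
  "coord_sup_well_defined e V \<longleftrightarrow>
     V \<noteq> {} \<and> (\<forall>k. bdd_above (coord e k ` V)) \<and>
     summable (\<lambda>k. (SUP v\<in>V. coord e k v) *\<^sub>R e k)"

definition coord_sup :: "(nat \<Rightarrow> 'a::{real_vector, t2_space}) \<Rightarrow> 'a set \<Rightarrow> 'a" where
  "coord_sup e V = (\<Sum>k. (SUP v\<in>V. coord e k v) *\<^sub>R e k)"

definition left_continuous ::
    "(nat \<Rightarrow> 'a::{real_vector, t2_space}) \<Rightarrow> ('a \<Rightarrow> real) \<Rightarrow> bool" where
  "left_continuous e g \<longleftrightarrow>
     (\<forall>x X. X \<longlonglongrightarrow> x \<and> (\<forall>k. coord_le e (X k) (X (Suc k))) \<longrightarrow> (\<lambda>k. g (X k)) \<longlonglongrightarrow> g x)"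


section \<open>The integral of functions with values in a Frechet space\<close>

definition step_function :: "real \<Rightarrow> real \<Rightarrow> (real \<Rightarrow> 'a) \<Rightarrow> bool" where
  "step_function a b h \<longleftrightarrow>
     finite (h ` {a..b}) \<and> (\<forall>c. {t\<in>{a..b}. h t = c} \<in> sets lebesgue)"

definition step_integral :: "real \<Rightarrow> real \<Rightarrow> (real \<Rightarrow> 'a::real_vector) \<Rightarrow> 'a" where
  "step_integral a b h =
     (\<Sum>c\<in>h ` {a..b} - {0}. measure lebesgue {t\<in>{a..b}. h t = c} *\<^sub>R c)"

definition step_approximation ::
    "(nat \<Rightarrow> 'a::{real_vector, t2_space} \<Rightarrow> real) \<Rightarrow> real \<Rightarrow> real \<Rightarrow>
       (real \<Rightarrow> 'a) \<Rightarrow> (nat \<Rightarrow> real \<Rightarrow> 'a) \<Rightarrow> bool" where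
  "step_approximation p a b g h \<longleftrightarrow>
     (\<forall>n. step_function a b (h n)) \<and>
     (AE t in lebesgue_on {a..b}. (\<lambda>n. h n t) \<longlonglongrightarrow> g t) \<and>
     (\<forall>s. ((\<lambda>(n, m). \<integral>t. p s (h n t - h m t) \<partial>lebesgue_on {a..b}) \<longlongrightarrow> 0)
            (sequentially \<times>\<^sub>F sequentially))"

definition frechet_integrable ::
    "(nat \<Rightarrow> 'a::{real_vector, t2_space} \<Rightarrow> real) \<Rightarrow> real \<Rightarrow> real \<Rightarrow> (real \<Rightarrow> 'a) \<Rightarrow> bool" where
  "frechet_integrable p a b g \<longleftrightarrow> (\<exists>h. step_approximation p a b g h)"

text \<open>In a Frechet space the limit exists and does not depend on the approximating sequence.\<close>

definition frechet_integral ::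
    "(nat \<Rightarrow> 'a::{real_vector, t2_space} \<Rightarrow> real) \<Rightarrow> real \<Rightarrow> real \<Rightarrow> (real \<Rightarrow> 'a) \<Rightarrow> 'a" where
  "frechet_integral p a b g =
     (THE I. \<exists>h. step_approximation p a b g h \<and> (\<lambda>n. step_integral a b (h n)) \<longlonglongrightarrow> I)"


section \<open>The initial value problem\<close>

text \<open>
  Functions on \<open>[0, T]\<close> are represented by total functions on the reals; their values outside
  the interval are irrelevant.
\<close>

definition ivp_solution ::
    "(nat \<Rightarrow> 'a::{real_vector, t2_space} \<Rightarrow> real) \<Rightarrow> real \<Rightarrow> (real \<Rightarrow> 'a \<Rightarrow> 'a) \<Rightarrow> 'a \<Rightarrow>
       (real \<Rightarrow> 'a) \<Rightarrow> bool" where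
  "ivp_solution p T f x0 x \<longleftrightarrow>
     continuous_on {0..T} x \<and>
     frechet_integrable p 0 T (\<lambda>t. f t (x t)) \<and>
     (\<forall>t\<in>{0..T}. x t = x0 + frechet_integral p 0 t (\<lambda>\<xi>. f \<xi> (x \<xi>)))"

end

theory Submission
  imports Defs
begin

text \<open>
  The integral operator \<open>\<Phi> u (t) = x0 + \<integral>\<^sub>0\<^sup>t f(\<xi>, u(\<xi>)) d\<xi>\<close> (called \<open>picard\<close> below) is monotone, and
  solutions are its fixed points. The heart of the matter is that above every subsolution
  \<open>u \<lless> \<Phi> u\<close> there is a solution: the iterates \<open>\<Phi>\<^sup>n u\<close> increase, they are bounded above since
  \<open>f \<lless> C\<close>, and left continuity together with dominated convergence turns their limit into a fixed
  point (\<open>solution_above_subsolution\<close>). This is used three times. By hypothesis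
  some constant path is a subsolution, so there is a solution. The coordinatewise maximum of
  two solutions is a subsolution, so the solutions are directed upwards. Finally the supremum of all
  solutions is a subsolution, since \<open>v = \<Phi> v \<lless> \<Phi> (sup Q)\<close> for every solution \<open>v\<close>; a solution above
  it cannot exceed it, hence equals it.

  For this argument \<open>\<Phi>\<close> must be defined at the paths in question, that is,
  \<open>t \<mapsto> f(t, u(t))\<close> must be integrable although \<open>f\<close> is only left continuous in its second argument. If
  \<open>u\<close> is order bounded with continuous coordinates, then \<open>u\<close> is the increasing limit of the step paths
  formed by the infima of \<open>u\<close> over dyadic intervals, and left continuity transfers measurability to
  the limit (\<open>superposition_integrable\<close>). The supremum of the solutions has continuous coordinates
  for the following reason. Fix a solution \<open>v0\<close>. By directedness only solutions \<open>w\<close> above \<open>v0\<close>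
  matter, and since \<open>f(t, v0(t)) \<lless> f(t, w(t)) \<lless> C\<close>, their increments are controlled by one
  integrable function that does not depend on \<open>w\<close>.

  Working coordinate by coordinate is legitimate because the basis is unconditional. Elements with
  prescribed coordinates exist within order intervals, and in an order interval coordinatewise
  convergence is convergence in the space. Moreover the solid seminorms
  \<open>x \<mapsto> sup p(\<Sum> c\<^sub>k x\<^sub>k e\<^sub>k)\<close>, the supremum being over finite sums with \<open>\<bar>c\<^sub>k\<bar> \<le> 1\<close>, are continuous by
  an open mapping argument. This gives continuity of the coordinates, and it shows that a function is
  integrable as soon as its coordinates are measurable and its solid seminorms have integrable
  majorants (\<open>frechet_integrableI\<close>); so integrals and dominated convergence reduce to the
  coordinates.
\<close>

section \<open>Seminorms\<close>

lemma seminorm_add: "seminorm q \<Longrightarrow> q (x + y) \<le> q x + q y"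
  and seminorm_scaleR: "seminorm q \<Longrightarrow> q (r *\<^sub>R x) = \<bar>r\<bar> * q x"
  by (auto simp: seminorm_def)

lemma seminorm_zero: "seminorm q \<Longrightarrow> q 0 = 0"
  using seminorm_scaleR[of q 0 0] by simp

lemma seminorm_minus: "seminorm q \<Longrightarrow> q (- x) = q x"
  using seminorm_scaleR[of q "-1" x] by simp

lemma seminorm_minus_commute: "seminorm q \<Longrightarrow> q (x - y) = q (y - x)"
  using seminorm_minus[of q "x - y"] by simp

lemma seminorm_nonneg: "seminorm q \<Longrightarrow> 0 \<le> q x"
  using seminorm_add[of q x "- x"] seminorm_minus[of q x] seminorm_zero[of q] by simp

lemma seminorm_diff: "seminorm q \<Longrightarrow> q (x - y) \<le> q x + q y"
  using seminorm_add[of q x "- y"] seminorm_minus[of q y] by simp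

lemma seminorm_triangle: "seminorm q \<Longrightarrow> q (x - z) \<le> q (x - y) + q (y - z)"
  using seminorm_add[of q "x - y" "y - z"] by simp

lemma seminorm_abs_diff: "seminorm q \<Longrightarrow> \<bar>q x - q y\<bar> \<le> q (x - y)"
  using seminorm_add[of q "x - y" y] seminorm_add[of q "y - x" x] seminorm_minus_commute[of q x y]
  by auto

lemma seminorm_sum: "seminorm q \<Longrightarrow> q (sum g A) \<le> (\<Sum>i\<in>A. q (g i))"
proof (induction A rule: infinite_finite_induct)
  case (insert a A)
  then show ?case
    using seminorm_add[of q "g a" "sum g A"] by force
qed (auto simp: seminorm_zero)

lemma seminorm_sum_family:
  assumes "\<And>i. i \<in> A \<Longrightarrow> seminorm (q i)"
  shows "seminorm (\<lambda>x. \<Sum>i\<in>A. q i x)"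
  unfolding seminorm_def
proof (intro conjI allI)
  fix x y and r :: real
  show "(\<Sum>i\<in>A. q i (x + y)) \<le> (\<Sum>i\<in>A. q i x) + (\<Sum>i\<in>A. q i y)"
    using assms by (simp flip: sum.distrib add: sum_mono seminorm_add)
  show "(\<Sum>i\<in>A. q i (r *\<^sub>R x)) = \<bar>r\<bar> * (\<Sum>i\<in>A. q i x)"
    using assms by (simp add: sum_distrib_left seminorm_scaleR)
qed

lemma seminorm_SUP:
  assumes q: "\<And>i. i \<in> I \<Longrightarrow> seminorm (q i)" and I: "I \<noteq> {}"
    and bdd: "\<And>x. bdd_above ((\<lambda>i. q i x) ` I)"
  shows "seminorm (\<lambda>x. SUP i\<in>I. q i x)"
  unfolding seminorm_def
proof (intro conjI allI)
  have up: "q i x \<le> (SUP i\<in>I. q i x)" if "i \<in> I" for i x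
    by (intro cSUP_upper that bdd)
  fix x y
  show "(SUP i\<in>I. q i (x + y)) \<le> (SUP i\<in>I. q i x) + (SUP i\<in>I. q i y)"
  proof (rule cSUP_least[OF I])
    fix i assume i: "i \<in> I"
    show "q i (x + y) \<le> (SUP i\<in>I. q i x) + (SUP i\<in>I. q i y)"
      using seminorm_add[OF q[OF i], of x y] up[OF i, of x] up[OF i, of y] by linarith
  qed
  have le: "(SUP i\<in>I. q i (r *\<^sub>R x)) \<le> \<bar>r\<bar> * (SUP i\<in>I. q i x)" for r x
    by (rule cSUP_least[OF I]) (simp add: q up seminorm_scaleR mult_left_mono)
  fix r :: real
  show "(SUP i\<in>I. q i (r *\<^sub>R x)) = \<bar>r\<bar> * (SUP i\<in>I. q i x)"
  proof (cases "r = 0")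
    case True
    have "q i 0 = 0" if "i \<in> I" for i using q that seminorm_zero by blast
    then show ?thesis using True I by simp
  next
    case False
    have "(SUP i\<in>I. q i x) \<le> \<bar>inverse r\<bar> * (SUP i\<in>I. q i (r *\<^sub>R x))"
      using le[of "inverse r" "r *\<^sub>R x"] False by simp
    then have "\<bar>r\<bar> * (SUP i\<in>I. q i x) \<le> (SUP i\<in>I. q i (r *\<^sub>R x))"
      using False by (simp add: field_simps)
    with le[of r x] show ?thesis by simp
  qed
qed

text \<open>
  The constant \<open>2B / \<delta>\<close> comes from scaling \<open>x\<close> into the open ball of radius \<open>\<delta>\<close>; since \<open>p x\<close> may
  vanish, \<open>x\<close> is scaled by \<open>p x + \<eta>\<close> with an arbitrarily small \<open>\<eta> > 0\<close>.
\<close>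
lemma seminorm_le_if_bounded_near_0:
  assumes "seminorm q" "seminorm p" "\<delta> > 0" and B: "\<And>x. p x < \<delta> \<Longrightarrow> q x \<le> B"
  shows "q x \<le> (2 * B / \<delta>) * p x"
proof (rule dense_ge)
  have B0: "0 \<le> B"
    using B[of 0] assms seminorm_zero[of p] seminorm_zero[of q] by simp
  fix y assume y: "(2 * B / \<delta>) * p x < y"
  define \<eta> where "\<eta> = (y - (2 * B / \<delta>) * p x) / (2 * B / \<delta> + 1)"
  have pos: "2 * B / \<delta> + 1 > 0" using B0 assms by (simp add: add_nonneg_pos)
  have \<eta>: "\<eta> > 0" using y pos by (simp add: \<eta>_def)
  have px: "p x + \<eta> > 0" using \<eta> seminorm_nonneg[OF assms(2), of x] by simp
  define r where "r = \<delta> / (2 * (p x + \<eta>))"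
  have r: "r > 0" using px assms by (simp add: r_def)
  have "p (r *\<^sub>R x) = \<delta> * (p x / (2 * (p x + \<eta>)))"
    using r px assms(3) by (simp add: seminorm_scaleR[OF assms(2)] r_def)
  also have "\<dots> < \<delta> * 1"
    using px \<eta> assms(3) seminorm_nonneg[OF assms(2), of x]
    by (intro mult_strict_left_mono) (auto simp: field_simps)
  finally have "q (r *\<^sub>R x) \<le> B" using B by simp
  then have "r * q x \<le> B" using r by (simp add: seminorm_scaleR[OF assms(1)])
  then have "q x \<le> B / r" using r by (simp add: field_simps)
  also have "\<dots> = (2 * B / \<delta>) * p x + (2 * B / \<delta>) * \<eta>"
    using px assms(3) by (simp add: r_def field_simps)
  also have "(2 * B / \<delta>) * \<eta> \<le> (2 * B / \<delta> + 1) * \<eta>" using \<eta> by (intro mult_right_mono) auto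
  also have "(2 * B / \<delta> + 1) * \<eta> = y - (2 * B / \<delta>) * p x" using pos by (simp add: \<eta>_def)
  finally show "q x \<le> y" by simp
qed

section \<open>Convergence in a Frechet space\<close>

context frechet_space
begin

lemmas p_add = seminorm_add[OF seminorm]
  and p_scaleR = seminorm_scaleR[OF seminorm]
  and p_zero = seminorm_zero[OF seminorm]
  and p_minus = seminorm_minus[OF seminorm]
  and p_minus_commute = seminorm_minus_commute[OF seminorm]
  and p_nonneg = seminorm_nonneg[OF seminorm]
  and p_diff = seminorm_diff[OF seminorm]
  and p_triangle = seminorm_triangle[OF seminorm]
  and p_abs_diff = seminorm_abs_diff[OF seminorm]
  and p_sum = seminorm_sum[OF seminorm]

lemma open_seminorm_ball: "open {y. p s (y - x) < \<epsilon>}"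
  unfolding open_iff
proof
  fix y assume y: "y \<in> {y. p s (y - x) < \<epsilon>}"
  have "z \<in> {y. p s (y - x) < \<epsilon>}" if "\<forall>i\<le>s. p i (z - y) < \<epsilon> - p s (y - x)" for z
    using that p_triangle[of s z x y] by fastforce
  then show "\<exists>n. \<exists>\<delta>>0. {z. \<forall>i\<le>n. p i (z - y) < \<delta>} \<subseteq> {y. p s (y - x) < \<epsilon>}"
    using y by (intro exI[of _ s] exI[of _ "\<epsilon> - p s (y - x)"]) auto
qed

lemma tendsto_iff_seminorms: "(X \<longlongrightarrow> l) F \<longleftrightarrow> (\<forall>s. ((\<lambda>n. p s (X n - l)) \<longlongrightarrow> 0) F)"
proof
  assume X: "(X \<longlongrightarrow> l) F"
  show "\<forall>s. ((\<lambda>n. p s (X n - l)) \<longlongrightarrow> 0) F"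
  proof (intro allI tendstoI)
    fix s and \<epsilon> :: real assume "\<epsilon> > 0"
    then have "eventually (\<lambda>n. X n \<in> {y. p s (y - l) < \<epsilon>}) F"
      by (intro topological_tendstoD[OF X] open_seminorm_ball) (auto simp: p_zero)
    then show "eventually (\<lambda>n. dist (p s (X n - l)) 0 < \<epsilon>) F"
      by eventually_elim (simp add: p_nonneg)
  qed
next
  assume X: "\<forall>s. ((\<lambda>n. p s (X n - l)) \<longlongrightarrow> 0) F"
  show "(X \<longlongrightarrow> l) F"
  proof (rule topological_tendstoI)
    fix U assume "open U" "l \<in> U"
    then obtain n \<epsilon> where n: "\<epsilon> > 0" "{y. \<forall>i\<le>n. p i (y - l) < \<epsilon>} \<subseteq> U"
      unfolding open_iff by blast
    have "eventually (\<lambda>j. \<forall>i\<in>{..n}. p i (X j - l) < \<epsilon>) F"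
      using X n(1) by (intro eventually_ball_finite ballI) (auto intro: order_tendstoD)
    then show "eventually (\<lambda>j. X j \<in> U) F"
      by eventually_elim (use n in auto)
  qed
qed

lemma eq_if_seminorms_0:
  assumes "\<And>s. p s (x - y) = 0" shows "x = y"
proof -
  have "(\<lambda>_::nat. x) \<longlonglongrightarrow> y" "(\<lambda>_::nat. x) \<longlonglongrightarrow> x"
    using assms by (auto simp: tendsto_iff_seminorms)
  then show ?thesis using LIMSEQ_unique by blast
qed

text \<open>
  The type of the space carries no type class of topological vector spaces, so the continuity of the
  vector operations is derived from the seminorms.
\<close>
lemma frechet_tendsto_add:
  fixes x y :: 'a
  assumes "(X \<longlongrightarrow> x) F" "(Y \<longlongrightarrow> y) F" shows "((\<lambda>n. X n + Y n) \<longlongrightarrow> x + y) F"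
  unfolding tendsto_iff_seminorms
proof
  fix s
  have "((\<lambda>n. p s (X n - x) + p s (Y n - y)) \<longlongrightarrow> 0 + 0) F"
    using assms unfolding tendsto_iff_seminorms by (intro tendsto_add) auto
  then show "((\<lambda>n. p s (X n + Y n - (x + y))) \<longlongrightarrow> 0) F"
    by (rule Lim_null_comparison[rotated, OF tendsto_eq_rhs])
      (auto simp: p_nonneg add_diff_add intro!: always_eventually p_add)
qed

lemma frechet_tendsto_scaleR:
  fixes x :: 'a
  assumes "(r \<longlongrightarrow> a) F" shows "((\<lambda>n. r n *\<^sub>R x) \<longlongrightarrow> a *\<^sub>R x) F"
  unfolding tendsto_iff_seminorms
proof
  fix s
  have "((\<lambda>n. \<bar>r n - a\<bar> * p s x) \<longlongrightarrow> 0 * p s x) F"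
    using assms by (intro tendsto_mult_right tendsto_rabs_zero) (simp add: LIM_zero)
  then show "((\<lambda>n. p s (r n *\<^sub>R x - a *\<^sub>R x)) \<longlongrightarrow> 0) F"
    by (simp add: p_scaleR flip: scaleR_left_diff_distrib)
qed

lemma frechet_tendsto_const_scaleR:
  fixes x :: 'a
  assumes "(X \<longlongrightarrow> x) F" shows "((\<lambda>n. a *\<^sub>R X n) \<longlongrightarrow> a *\<^sub>R x) F"
  unfolding tendsto_iff_seminorms
proof
  fix s
  have "((\<lambda>n. \<bar>a\<bar> * p s (X n - x)) \<longlongrightarrow> \<bar>a\<bar> * 0) F"
    using assms unfolding tendsto_iff_seminorms by (intro tendsto_mult_left) auto
  then show "((\<lambda>n. p s (a *\<^sub>R X n - a *\<^sub>R x)) \<longlongrightarrow> 0) F"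
    by (simp add: p_scaleR flip: scaleR_right_diff_distrib)
qed

lemma frechet_tendsto_diff:
  fixes x y :: 'a
  assumes "(X \<longlongrightarrow> x) F" "(Y \<longlongrightarrow> y) F" shows "((\<lambda>n. X n - Y n) \<longlongrightarrow> x - y) F"
  using frechet_tendsto_add[OF assms(1) frechet_tendsto_const_scaleR[OF assms(2), of "-1"]] by simp

lemma frechet_tendsto_sum:
  fixes x :: "_ \<Rightarrow> 'a"
  shows "(\<And>i. i \<in> A \<Longrightarrow> ((\<lambda>n. X n i) \<longlongrightarrow> x i) F) \<Longrightarrow> ((\<lambda>n. \<Sum>i\<in>A. X n i) \<longlongrightarrow> (\<Sum>i\<in>A. x i)) F"
  by (induction A rule: infinite_finite_induct) (auto intro: frechet_tendsto_add)

lemma tendsto_seminorm: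
  assumes "(X \<longlongrightarrow> x) F" shows "((\<lambda>n. p s (X n)) \<longlongrightarrow> p s x) F"
proof -
  have "((\<lambda>n. p s (X n) - p s x) \<longlongrightarrow> 0) F"
  proof (rule Lim_null_comparison)
    show "((\<lambda>n. p s (X n - x)) \<longlongrightarrow> 0) F"
      using assms unfolding tendsto_iff_seminorms by blast
    show "eventually (\<lambda>n. norm (p s (X n) - p s x) \<le> p s (X n - x)) F"
      unfolding real_norm_def by (intro always_eventually allI p_abs_diff)
  qed
  then show ?thesis by (simp add: LIM_zero_iff)
qed

lemma closure_seminorm_approx:
  assumes "x \<in> closure V" "\<epsilon> > 0" obtains v where "v \<in> V" "p s (x - v) < \<epsilon>"
proof -
  have "x \<in> {y. p s (y - x) < \<epsilon>} \<inter> closure V" using assms by (simp add: p_zero)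
  then have "{y. p s (y - x) < \<epsilon>} \<inter> V \<noteq> {}"
    using open_Int_closure_eq_empty[OF open_seminorm_ball] by blast
  then show ?thesis using that by (auto simp: p_minus_commute)
qed

text \<open>
  Replacing the seminorms by their partial sums does not change the topology and makes them increasing,
  so that balls of a single seminorm form a base of neighbourhoods.
\<close>
lemma cumulative_frechet_space: "frechet_space (\<lambda>n x. \<Sum>i\<le>n. p i x)"
proof
  have le: "p i x \<le> (\<Sum>i\<le>n. p i x)" if "i \<le> n" for i n x
    using that by (intro member_le_sum) (auto simp: p_nonneg)
  show "seminorm (\<lambda>x. \<Sum>i\<le>n. p i x)" for n
    by (intro seminorm_sum_family seminorm)
  show "open U \<longleftrightarrow>
      (\<forall>x\<in>U. \<exists>n. \<exists>\<epsilon>>0. {y. \<forall>i\<le>n. (\<Sum>j\<le>i. p j (y - x)) < \<epsilon>} \<subseteq> U)" for U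
  proof
    assume U: "open U"
    show "\<forall>x\<in>U. \<exists>n. \<exists>\<epsilon>>0. {y. \<forall>i\<le>n. (\<Sum>j\<le>i. p j (y - x)) < \<epsilon>} \<subseteq> U"
    proof
      fix x assume "x \<in> U"
      then obtain n \<epsilon> where "\<epsilon> > 0" "{y. \<forall>i\<le>n. p i (y - x) < \<epsilon>} \<subseteq> U"
        using U unfolding open_iff by blast
      moreover have "{y. \<forall>i\<le>n. (\<Sum>j\<le>i. p j (y - x)) < \<epsilon>} \<subseteq> {y. \<forall>i\<le>n. p i (y - x) < \<epsilon>}"
        by (auto intro: le_less_trans[OF le[OF order_refl]])
      ultimately show "\<exists>n. \<exists>\<epsilon>>0. {y. \<forall>i\<le>n. (\<Sum>j\<le>i. p j (y - x)) < \<epsilon>} \<subseteq> U" by blast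
    qed
  next
    assume *: "\<forall>x\<in>U. \<exists>n. \<exists>\<epsilon>>0. {y. \<forall>i\<le>n. (\<Sum>j\<le>i. p j (y - x)) < \<epsilon>} \<subseteq> U"
    show "open U" unfolding open_iff
    proof
      fix x assume "x \<in> U"
      then obtain n \<epsilon> where n: "\<epsilon> > 0" "{y. \<forall>i\<le>n. (\<Sum>j\<le>i. p j (y - x)) < \<epsilon>} \<subseteq> U"
        using * by blast
      have "(\<Sum>j\<le>i. p j (y - x)) < \<epsilon>"
        if y: "\<forall>i\<le>n. p i (y - x) < \<epsilon> / (n + 1)" and i: "i \<le> n" for y i
      proof -
        have "(\<Sum>j\<le>i. p j (y - x)) < (\<Sum>j\<le>i. \<epsilon> / (n + 1))"
          using y i by (intro sum_strict_mono) auto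
        also have "\<dots> \<le> \<epsilon>" using i n(1) by (simp add: field_simps)
        finally show ?thesis .
      qed
      then have "{y. \<forall>i\<le>n. p i (y - x) < \<epsilon> / (n + 1)} \<subseteq> U" using n(2) by auto
      then show "\<exists>n. \<exists>\<epsilon>>0. {y. \<forall>i\<le>n. p i (y - x) < \<epsilon>} \<subseteq> U"
        using n(1) by (intro exI[of _ n] exI[of _ "\<epsilon> / (n + 1)"]) auto
    qed
  qed
  show "\<exists>l. X \<longlonglongrightarrow> l" if X: "\<And>s. \<forall>\<epsilon>>0. \<exists>N. \<forall>m\<ge>N. \<forall>n\<ge>N. (\<Sum>i\<le>s. p i (X m - X n)) < \<epsilon>" for X
    by (rule complete) (meson X le le_less_trans order_refl)
qed

section \<open>The open mapping principle\<close>

text \<open>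
  Baire's theorem by nested balls: if no \<open>A j\<close> contained a ball, one could shrink a ball successively
  so as to avoid \<open>A 0\<close>, \<open>A 1\<close>, and so on, and by completeness the centres converge to a point outside
  all of them.
\<close>
lemma baire_seminorm_ball:
  assumes mono: "\<And>m n x. m \<le> n \<Longrightarrow> p m x \<le> p n x"
    and closed: "\<And>j::nat. closed (A j)" and cover: "(\<Union>j. A j) = UNIV"
  shows "\<exists>j z n. \<exists>\<epsilon>>0. {y. p n (y - z) < \<epsilon>} \<subseteq> A j"
proof (rule ccontr)
  assume neg: "\<not> ?thesis"
  \<comment> \<open>A ball is a triple of centre, index of the seminorm, and radius; closed balls are stable under limits.\<close>
  define ball where "ball = (\<lambda>(y, m, r). {w. p m (w - y) \<le> r})"
  have step: "\<exists>S'. (0 < snd (snd S') \<and> snd (snd S') \<le> (1/2)^j \<and> j \<le> fst (snd S')) \<and>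
          ball S' \<subseteq> ball S \<and> ball S' \<inter> A j = {}"
    if S: "0 < snd (snd S)" for S j
  proof -
    obtain z n r where [simp]: "S = (z, n, r)" by (cases S)
    have r: "r > 0" using S by simp
    have "\<not> {y. p n (y - z) < r / 2} \<subseteq> A j" using neg r by (meson half_gt_zero)
    then obtain y where y: "p n (y - z) < r / 2" "y \<notin> A j" by blast
    have "open (- A j)" using closed by auto
    then obtain m \<epsilon> where m: "\<epsilon> > 0" "{w. \<forall>i\<le>m. p i (w - y) < \<epsilon>} \<subseteq> - A j"
      using y(2) unfolding open_iff by blast
    define k where "k = max m (max n j)"
    define \<delta> where "\<delta> = min (\<epsilon> / 2) (min (r / 2) ((1/2)^j))"
    have "p n (w - z) \<le> r" if "p k (w - y) \<le> \<delta>" for w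
    proof -
      have "p n (w - y) \<le> r / 2"
        using that mono[of n k "w - y"] by (simp add: k_def \<delta>_def le_max_iff_disj)
      then show ?thesis using p_triangle[of n w z y] y(1) by linarith
    qed
    moreover have "w \<notin> A j" if w: "p k (w - y) \<le> \<delta>" for w
    proof -
      have "p i (w - y) < \<epsilon>" if "i \<le> m" for i
        using w that mono[of i k "w - y"] m(1) by (auto simp: k_def \<delta>_def le_max_iff_disj)
      then show ?thesis using m(2) by blast
    qed
    ultimately show ?thesis
      using m(1) r by (intro exI[of _ "(y, k, \<delta>)"]) (auto simp: ball_def k_def \<delta>_def)
  qed
  have "\<exists>S. \<forall>j. (0 < snd (snd (S j))) \<and>
      ((snd (snd (S (Suc j))) \<le> (1/2)^j \<and> j \<le> fst (snd (S (Suc j)))) \<and>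
        ball (S (Suc j)) \<subseteq> ball (S j) \<and> ball (S (Suc j)) \<inter> A j = {})"
    by (rule dependent_nat_choice) (use step in \<open>auto intro!: exI[of _ "1::real"]\<close>)
  then obtain S where S: "\<And>j. 0 < snd (snd (S j))" "\<And>j. snd (snd (S (Suc j))) \<le> (1/2)^j"
      "\<And>j. j \<le> fst (snd (S (Suc j)))" "\<And>j. ball (S (Suc j)) \<subseteq> ball (S j)"
      "\<And>j. ball (S (Suc j)) \<inter> A j = {}"
    by blast
  define y where "y j = fst (S j)" for j
  have dec: "ball (S j) \<subseteq> ball (S i)" if "i \<le> j" for i j
    using that S(4) by (rule lift_Suc_antimono_le[rotated])
  have yin: "y j \<in> ball (S j)" for j
    using S(1)[of j] by (cases "S j") (simp add: ball_def y_def p_zero)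
  have near: "p (fst (snd (S j))) (y i - y j) \<le> snd (snd (S j))" if "j \<le> i" for i j
    using subsetD[OF dec[OF that] yin] by (cases "S j") (simp add: ball_def y_def)
  have "\<exists>l. y \<longlonglongrightarrow> l"
  proof (rule complete, intro allI impI)
    fix s and \<epsilon> :: real assume \<epsilon>: "\<epsilon> > 0"
    obtain j0 where j0: "(1/2)^j0 < \<epsilon> / 2" using \<epsilon> real_arch_pow_inv[of "\<epsilon>/2" "1/2"] by auto
    define j where "j = max j0 s"
    have "p s (y i - y (Suc j)) < \<epsilon> / 2" if "Suc j \<le> i" for i
    proof -
      have "p s (y i - y (Suc j)) \<le> p (fst (snd (S (Suc j)))) (y i - y (Suc j))"
        using S(3)[of j] by (intro mono) (simp add: j_def)
      also have "\<dots> \<le> (1/2)^j" using near[OF that] S(2)[of j] by linarith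
      also have "\<dots> \<le> (1/2)^j0" by (intro power_decreasing) (auto simp: j_def)
      finally show ?thesis using j0 by simp
    qed
    then have "p s (y m - y n) < \<epsilon>" if "m \<ge> Suc j" "n \<ge> Suc j" for m n
      using that p_triangle[of s "y m" "y n" "y (Suc j)"] p_minus_commute[of s "y n" "y (Suc j)"]
      by (smt (verit) field_sum_of_halves)
    then show "\<exists>N. \<forall>m\<ge>N. \<forall>n\<ge>N. p s (y m - y n) < \<epsilon>" by blast
  qed
  then obtain l where l: "y \<longlonglongrightarrow> l" by blast
  have "l \<in> ball (S j)" for j
  proof -
    have "(\<lambda>i. p (fst (snd (S j))) (y i - y j)) \<longlonglongrightarrow> p (fst (snd (S j))) (l - y j)"
      by (intro tendsto_seminorm frechet_tendsto_diff l tendsto_const)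
    then have "p (fst (snd (S j))) (l - y j) \<le> snd (snd (S j))"
      using near by (intro LIMSEQ_le_const2) auto
    then show ?thesis by (cases "S j") (auto simp: ball_def y_def)
  qed
  then have "l \<notin> A j" for j using S(5)[of j] by blast
  then show False using cover by blast
qed

text \<open>
  A second family of seminorms for which the Cauchy sequences converge to the limit they have in the
  given topology is dominated by the given one. As in the open mapping theorem, the closure of each
  ball \<open>q m v < r\<close> contains a ball of the original topology by Baire's theorem; a point near \<open>0\<close> is then
  a sum of corrections whose \<open>q\<close>-seminorms decrease geometrically. The hypothesis on Cauchy sequences
  makes this series converge to that point for the seminorms \<open>q\<close> as well.
\<close>
lemma open_mapping_monotone:
  fixes q :: "nat \<Rightarrow> 'a \<Rightarrow> real"
  assumes mono: "\<And>m n x. m \<le> n \<Longrightarrow> p m x \<le> p n x"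
    and q: "\<And>s. seminorm (q s)" and qmono: "\<And>m n x. m \<le> n \<Longrightarrow> q m x \<le> q n x"
    and compat: "\<And>X x s. (\<And>s. \<forall>\<epsilon>>0. \<exists>N. \<forall>m\<ge>N. \<forall>n\<ge>N. q s (X m - X n) < \<epsilon>) \<Longrightarrow> X \<longlonglongrightarrow> x
                  \<Longrightarrow> (\<lambda>n. q s (X n - x)) \<longlonglongrightarrow> 0"
  shows "\<exists>n M. \<forall>x. q s x \<le> M * p n x"
proof -
  have approx: "\<exists>n \<delta>. \<delta> > 0 \<and> n \<ge> m \<and> \<delta> \<le> r \<and>
      (\<forall>x k \<eta>. p n x < \<delta> \<longrightarrow> \<eta> > 0 \<longrightarrow> (\<exists>v. q m v < r \<and> p k (x - v) < \<eta>))"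
    if r: "r > 0" for m and r :: real
  proof -
    define A where "A j = closure {v. q m v \<le> real j}" for j
    have "v \<in> A (nat \<lceil>q m v\<rceil>)" for v
      unfolding A_def by (rule subsetD[OF closure_subset]) (simp add: seminorm_nonneg[OF q])
    then have "(\<Union>j. A j) = UNIV" by blast
    then obtain j z n \<epsilon> where n: "\<epsilon> > 0" "{y. p n (y - z) < \<epsilon>} \<subseteq> A j"
      using baire_seminorm_ball[OF mono, of A] by (auto simp: A_def)
    \<comment> \<open>Differences move the ball from the centre \<open>z\<close> to the origin, at the price of doubling the bound.\<close>
    have diff: "\<exists>v. q m v \<le> 2 * j \<and> p k (x - v) < \<eta>" if x: "p n x < \<epsilon>" and \<eta>: "\<eta> > 0" for x k \<eta>
    proof -
      have "z + x \<in> A j" "z \<in> A j" using n x by (auto simp: p_zero)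
      then obtain v w where v: "q m v \<le> j" "p k (z + x - v) < \<eta> / 2"
          and w: "q m w \<le> j" "p k (z - w) < \<eta> / 2"
        using \<eta> unfolding A_def by (metis closure_seminorm_approx half_gt_zero mem_Collect_eq)
      have "q m (v - w) \<le> 2 * j" using seminorm_diff[OF q, of m v w] v w by simp
      moreover have "x - (v - w) = (z + x - v) - (z - w)" by simp
      then have "p k (x - (v - w)) \<le> p k (z + x - v) + p k (z - w)" using p_diff by metis
      then have "p k (x - (v - w)) < \<eta>" using v w by linarith
      ultimately show ?thesis by blast
    qed
    define a where "a = r / (2 * j + 1)"
    have a: "a > 0" using r by (simp add: a_def)
    define n' where "n' = max n m"
    have "\<exists>v. q m v < r \<and> p k (x - v) < \<eta>"
      if x: "p n' x < min r (a * \<epsilon>)" and \<eta>: "\<eta> > 0" for x k \<eta>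
    proof -
      have "p n (inverse a *\<^sub>R x) < \<epsilon>"
        using x a mono[of n n' x] by (simp add: p_scaleR field_simps n'_def)
      then obtain v where v: "q m v \<le> 2 * j" "p k (inverse a *\<^sub>R x - v) < \<eta> / a"
        using diff \<eta> a by (meson divide_pos_pos)
      have "q m (a *\<^sub>R v) \<le> a * (2 * j)" using a v(1) by (simp add: seminorm_scaleR[OF q])
      also have "\<dots> < r" using r by (simp add: a_def field_simps)
      finally have "q m (a *\<^sub>R v) < r" .
      moreover have "x - a *\<^sub>R v = a *\<^sub>R (inverse a *\<^sub>R x - v)"
        using a by (simp add: scaleR_right_diff_distrib)
      then have "p k (x - a *\<^sub>R v) = a * p k (inverse a *\<^sub>R x - v)"
        using a by (simp add: p_scaleR)
      then have "p k (x - a *\<^sub>R v) < \<eta>" using a v(2) by (simp add: field_simps)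
      ultimately show ?thesis by blast
    qed
    then show ?thesis
      using r a n(1) by (intro exI[of _ n'] exI[of _ "min r (a * \<epsilon>)"]) (auto simp: n'_def)
  qed
  have "\<forall>m. \<exists>n \<delta>. \<delta> > 0 \<and> n \<ge> m \<and> \<delta> \<le> (1/2)^m \<and>
      (\<forall>x k \<eta>. p n x < \<delta> \<longrightarrow> \<eta> > 0 \<longrightarrow> (\<exists>v. q m v < (1/2)^m \<and> p k (x - v) < \<eta>))"
    by (intro allI approx) simp
  then obtain N \<delta> where \<delta>: "\<And>m. \<delta> m > (0::real)" and N: "\<And>m. N m \<ge> m" and \<delta>2: "\<And>m. \<delta> m \<le> (1/2)^m"
    and corr: "\<And>m x k \<eta>. p (N m) x < \<delta> m \<Longrightarrow> \<eta> > 0 \<Longrightarrow> \<exists>v. q m v < (1/2)^m \<and> p k (x - v) < \<eta>"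
    by metis
  have "q s x \<le> 2" if x: "p (N s) x < \<delta> s" for x
  proof -
    \<comment> \<open>\<open>R i\<close> is the remainder of \<open>x\<close> after \<open>i\<close> corrections.\<close>
    have "\<exists>R. \<forall>i. (p (N (s + i)) (R i) < \<delta> (s + i) \<and> (i = 0 \<longrightarrow> R i = x)) \<and>
       q (s + i) (R i - R (Suc i)) < (1/2)^(s + i)"
    proof (rule dependent_nat_choice)
      fix y i assume y: "p (N (s + i)) y < \<delta> (s + i) \<and> (i = 0 \<longrightarrow> y = x)"
      obtain v where v: "q (s + i) v < (1/2)^(s + i)" "p (N (s + Suc i)) (y - v) < \<delta> (s + Suc i)"
        using corr y \<delta> by blast
      then show "\<exists>z. (p (N (s + Suc i)) z < \<delta> (s + Suc i) \<and> (Suc i = 0 \<longrightarrow> z = x)) \<and>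
          q (s + i) (y - z) < (1/2)^(s + i)"
        by (intro exI[of _ "y - v"]) simp
    qed (use x in auto)
    then obtain R where R: "\<And>i. p (N (s + i)) (R i) < \<delta> (s + i)" and R0: "R 0 = x"
      and Rq: "\<And>i. q (s + i) (R i - R (Suc i)) < (1/2)^(s + i)" by blast
    define X where "X i = x - R i" for i
    have X0: "X 0 = 0" by (simp add: X_def R0)
    have inc: "q t (X (Suc i) - X i) \<le> (1/2)^(s + i)" if "t \<le> s + i" for t i
      using Rq[of i] qmono[OF that, of "R i - R (Suc i)"] by (simp add: X_def)
    \<comment> \<open>The geometric bound is telescoped as a difference, because the plain bound \<open>2 (1/2)^(s + i)\<close> does not survive the induction step.\<close>
    have tele: "q t (X (i + d) - X i) \<le> 2 * (1/2)^(s + i) - 2 * (1/2)^(s + i + d)"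
      if "t \<le> s + i" for t i d
    proof (induction d)
      case (Suc d)
      have "q t (X (i + Suc d) - X i) \<le> q t (X (Suc (i + d)) - X (i + d)) + q t (X (i + d) - X i)"
        using seminorm_triangle[OF q, of t "X (i + Suc d)" "X i" "X (i + d)"] by simp
      also have "\<dots> \<le> (1/2)^(s + (i + d)) + (2 * (1/2)^(s + i) - 2 * (1/2)^(s + i + d))"
        using that by (intro add_mono inc Suc) simp
      finally show ?case by (simp add: field_simps power_add)
    qed (simp add: seminorm_zero[OF q])
    have tele': "q t (X j - X i) \<le> 2 * (1/2)^(s + i)" if "t \<le> s + i" "i \<le> j" for t i j
      using tele[OF that(1), of "j - i"] that(2)
      by (smt (verit) le_add_diff_inverse zero_le_divide_1_iff zero_le_power)
    have "\<forall>\<epsilon>>0. \<exists>K. \<forall>m\<ge>K. \<forall>n\<ge>K. q t (X m - X n) < \<epsilon>" for t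
    proof (intro allI impI)
      fix \<epsilon> :: real assume \<epsilon>: "\<epsilon> > 0"
      obtain j0 where j0: "(1/2)^j0 < \<epsilon> / 4" using \<epsilon> real_arch_pow_inv[of "\<epsilon>/4" "1/2"] by auto
      define j where "j = max j0 t"
      have pw: "(1/2::real)^(s+j) \<le> (1/2)^j0" by (intro power_decreasing) (auto simp: j_def)
      have tj: "t \<le> s + j" by (simp add: j_def)
      have *: "q t (X m - X j) < \<epsilon> / 2" if "m \<ge> j" for m
        using tele'[OF tj that] pw j0 by linarith
      have "q t (X m - X n) < \<epsilon>" if "m \<ge> j" "n \<ge> j" for m n
        using *[OF that(1)] *[OF that(2)] seminorm_triangle[OF q, of t "X m" "X n" "X j"]
          seminorm_minus_commute[OF q, of t "X n" "X j"] by linarith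
      then show "\<exists>K. \<forall>m\<ge>K. \<forall>n\<ge>K. q t (X m - X n) < \<epsilon>" by blast
    qed
    moreover have "X \<longlonglongrightarrow> x"
      unfolding tendsto_iff_seminorms
    proof
      fix t
      have "p t (R i) \<le> (1/2)^i" if "i \<ge> t" for i
      proof -
        have "p t (R i) \<le> p (N (s + i)) (R i)" using N[of "s + i"] that by (intro mono) simp
        also have "\<dots> \<le> (1/2)^(s + i)" using R[of i] \<delta>2[of "s + i"] by linarith
        also have "\<dots> \<le> (1/2)^i" by (intro power_decreasing) auto
        finally show ?thesis .
      qed
      then have "eventually (\<lambda>i. norm (p t (R i)) \<le> (1/2)^i) sequentially"
        by (auto simp: eventually_sequentially p_nonneg)
      moreover have "(\<lambda>i. (1/2::real)^i) \<longlonglongrightarrow> 0" by (rule LIMSEQ_realpow_zero) auto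
      ultimately have "(\<lambda>i. p t (R i)) \<longlonglongrightarrow> 0" by (rule Lim_null_comparison)
      then show "(\<lambda>i. p t (X i - x)) \<longlonglongrightarrow> 0" by (simp add: X_def p_minus)
    qed
    ultimately have "(\<lambda>i. q s (X i - x)) \<longlonglongrightarrow> 0" by (rule compat)
    then have "(\<lambda>i. q s (X i - x) + 2) \<longlonglongrightarrow> 0 + 2" by (intro tendsto_intros)
    moreover have "q s x \<le> q s (X i - x) + 2" for i
    proof -
      have "(1/2::real)^s \<le> 1" by (simp add: power_le_one)
      then have "q s (X i) \<le> 2" using tele'[of s 0 i] X0 by simp
      then show ?thesis
        using seminorm_diff[OF q, of s "X i" "X i - x"] by simp
    qed
    ultimately show "q s x \<le> 2" using LIMSEQ_le_const by force
  qed
  then show ?thesis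
    using seminorm_le_if_bounded_near_0[OF q seminorm \<delta>] by blast
qed

lemma finer_complete_seminorms_continuous:
  fixes q :: "nat \<Rightarrow> 'a \<Rightarrow> real"
  assumes q: "\<And>s. seminorm (q s)"
    and compat: "\<And>X x s. (\<And>s. \<forall>\<epsilon>>0. \<exists>N. \<forall>m\<ge>N. \<forall>n\<ge>N. q s (X m - X n) < \<epsilon>) \<Longrightarrow> X \<longlonglongrightarrow> x
                  \<Longrightarrow> (\<lambda>n. q s (X n - x)) \<longlonglongrightarrow> 0"
  shows "\<exists>n M. \<forall>x. q s x \<le> M * (\<Sum>i\<le>n. p i x)"
proof -
  interpret P: frechet_space "\<lambda>n x. \<Sum>i\<le>n. p i x" by (rule cumulative_frechet_space)
  have le: "q i x \<le> (\<Sum>i\<le>n. q i x)" if "i \<le> n" for i n x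
    using that by (intro member_le_sum) (auto simp: seminorm_nonneg[OF q])
  have "\<exists>n M. \<forall>x. (\<Sum>i\<le>s. q i x) \<le> M * (\<Sum>i\<le>n. p i x)"
  proof (rule P.open_mapping_monotone)
    fix X x s
    assume X: "\<And>s. \<forall>\<epsilon>>0. \<exists>N. \<forall>m\<ge>N. \<forall>n\<ge>N. (\<Sum>i\<le>s. q i (X m - X n)) < \<epsilon>" "X \<longlonglongrightarrow> x"
    have "(\<lambda>n. \<Sum>i\<le>s. q i (X n - x)) \<longlonglongrightarrow> (\<Sum>i\<le>s. 0)"
      by (intro tendsto_sum compat X(2)) (meson X(1) le le_less_trans order_refl)
    then show "(\<lambda>n. \<Sum>i\<le>s. q i (X n - x)) \<longlonglongrightarrow> 0" by simp
  qed (auto intro!: sum_mono2 seminorm_sum_family q p_nonneg seminorm_nonneg[OF q])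
  then show ?thesis using le[OF order_refl] by (meson order_trans)
qed

end

section \<open>Unconditional series\<close>

lemma ex_bij_betw_mapping_subset:
  assumes A: "finite A" and BC: "B \<subseteq> A" "C \<subseteq> A" "card B = card C"
  shows "\<exists>\<sigma>. bij_betw \<sigma> A A \<and> \<sigma> ` B = C"
proof -
  have fin: "finite B" "finite C" using A BC finite_subset by auto
  obtain f where f: "bij_betw f B C" using finite_same_card_bij[OF fin] BC by blast
  have "card (A - B) = card (A - C)" using BC fin by (simp add: card_Diff_subset)
  then obtain g where g: "bij_betw g (A - B) (A - C)"
    using finite_same_card_bij[of "A - B" "A - C"] A by blast
  define \<sigma> where "\<sigma> k = (if k \<in> B then f k else g k)" for k
  have 1: "bij_betw \<sigma> B C" using f by (subst bij_betw_cong[where g = f]) (auto simp: \<sigma>_def)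
  have 2: "bij_betw \<sigma> (A - B) (A - C)" using g by (subst bij_betw_cong[where g = g]) (auto simp: \<sigma>_def)
  have "bij_betw \<sigma> (B \<union> (A - B)) (C \<union> (A - C))" by (rule bij_betw_combine[OF 1 2]) auto
  then have "bij_betw \<sigma> A A" using BC by (simp add: Un_absorb1)
  with 1 show ?thesis by (auto simp: bij_betw_def)
qed

text \<open>
  For coefficients in \<open>[0, 1]\<close> the sum is a convex combination of the subset sums, as one sees by
  splitting off one coefficient at a time; the offset \<open>z\<close> makes the induction work.
\<close>
lemma seminorm_convex_sum_le:
  assumes q: "seminorm q" and "finite F" and c: "\<And>k. 0 \<le> c k \<and> c k \<le> 1"
    and B: "\<And>G. G \<subseteq> F \<Longrightarrow> q (z + (\<Sum>k\<in>G. y k)) \<le> B"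
  shows "q (z + (\<Sum>k\<in>F. c k *\<^sub>R y k)) \<le> B"
  using assms(2) B
proof (induction F arbitrary: z rule: finite_induct)
  case empty
  then show ?case by force
next
  case (insert a F)
  let ?S = "\<Sum>k\<in>F. c k *\<^sub>R y k"
  have "q (z + ?S) \<le> B" using insert.prems by (intro insert.IH) blast
  moreover have "q ((z + y a) + ?S) \<le> B"
  proof (rule insert.IH)
    fix G assume "G \<subseteq> F"
    then have "insert a G \<subseteq> insert a F" "finite G" "a \<notin> G"
      using insert.hyps finite_subset by auto
    then show "q (z + y a + sum y G) \<le> B"
      using insert.prems[of "insert a G"] by (simp add: algebra_simps)
  qed
  ultimately have "(1 - c a) * q (z + ?S) + c a * q ((z + y a) + ?S) \<le> (1 - c a) * B + c a * B"
    using c[of a] by (intro add_mono mult_left_mono) auto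
  then have le: "(1 - c a) * q (z + ?S) + c a * q ((z + y a) + ?S) \<le> B"
    by (simp add: algebra_simps)
  have "z + (\<Sum>k\<in>insert a F. c k *\<^sub>R y k) = (1 - c a) *\<^sub>R (z + ?S) + c a *\<^sub>R ((z + y a) + ?S)"
    using insert.hyps by (simp add: algebra_simps)
  then have "q (z + (\<Sum>k\<in>insert a F. c k *\<^sub>R y k))
      \<le> q ((1 - c a) *\<^sub>R (z + ?S)) + q (c a *\<^sub>R ((z + y a) + ?S))"
    using seminorm_add[OF q] by metis
  also have "\<dots> = (1 - c a) * q (z + ?S) + c a * q ((z + y a) + ?S)"
    using c[of a] by (simp add: seminorm_scaleR[OF q])
  finally show ?case using le by simp
qed

text \<open>
  Split the coefficients into positive and negative parts.
\<close>
lemma seminorm_solid_sum_le: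
  assumes q: "seminorm q" and F: "finite F" and c: "\<And>k. \<bar>c k\<bar> \<le> 1"
    and B: "\<And>G. G \<subseteq> F \<Longrightarrow> q (\<Sum>k\<in>G. y k) \<le> B"
  shows "q (\<Sum>k\<in>F. c k *\<^sub>R y k) \<le> 2 * B"
proof -
  have "q (0 + (\<Sum>k\<in>F. max (c k) 0 *\<^sub>R y k)) \<le> B"
    "q (0 + (\<Sum>k\<in>F. max (- c k) 0 *\<^sub>R y k)) \<le> B"
    using c B by (intro seminorm_convex_sum_le[OF q F]; force simp: abs_le_iff)+
  moreover have "(\<Sum>k\<in>F. c k *\<^sub>R y k) = (\<Sum>k\<in>F. max (c k) 0 *\<^sub>R y k) - (\<Sum>k\<in>F. max (- c k) 0 *\<^sub>R y k)"
    unfolding sum_subtractf[symmetric]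
    by (intro sum.cong) (auto simp: max_def simp flip: scaleR_left_diff_distrib)
  ultimately show ?thesis
    using seminorm_diff[OF q, of "\<Sum>k\<in>F. max (c k) 0 *\<^sub>R y k" "\<Sum>k\<in>F. max (- c k) 0 *\<^sub>R y k"] by simp
qed

text \<open>
  If arbitrarily late finite blocks \<open>F\<close> had large sums, one could cut the natural numbers into
  consecutive intervals, each containing such an \<open>F\<close>, and permute every interval so that the elements
  of \<open>F\<close> come first. The partial sums of the permuted series then fail to be Cauchy.
\<close>
lemma (in frechet_space) permutable_series_small_tails:
  fixes x :: "nat \<Rightarrow> 'a"
  assumes sum: "\<And>\<pi>. bij \<pi> \<Longrightarrow> summable (\<lambda>k. x (\<pi> k))" and \<epsilon>: "\<epsilon> > 0"
  shows "\<exists>N. \<forall>F. finite F \<longrightarrow> F \<subseteq> {N..} \<longrightarrow> p s (\<Sum>k\<in>F. x k) < \<epsilon>"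
proof (rule ccontr)
  assume "\<not> ?thesis"
  then obtain F where F: "\<And>N. finite (F N)" "\<And>N. F N \<subseteq> {N..}" "\<And>N. p s (\<Sum>k\<in>F N. x k) \<ge> \<epsilon>"
    by (metis not_less)
  define nxt where "nxt N = Suc (Max (insert N (F N)))" for N
  have Fn: "F N \<subseteq> {N..<nxt N}" for N
    using F[of N] by (auto simp: nxt_def le_imp_less_Suc)
  have nxt: "N < nxt N" for N
    using F(1)[of N] by (auto simp: nxt_def le_imp_less_Suc)
  define b where "b i = (nxt ^^ i) 0" for i
  have b0: "b 0 = 0" and bS: "b (Suc i) = nxt (b i)" for i by (auto simp: b_def)
  have sm: "strict_mono b" using nxt by (auto simp: strict_mono_Suc_iff bS)
  define block where "block i = {b i..<b (Suc i)}" for i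
  have "\<exists>\<sigma>. bij_betw \<sigma> (block i) (block i) \<and> \<sigma> ` {b i..<b i + card (F (b i))} = F (b i)" for i
  proof (rule ex_bij_betw_mapping_subset)
    have "card (F (b i)) \<le> card (block i)"
      using Fn[of "b i"] by (intro card_mono) (auto simp: block_def bS)
    then show "{b i..<b i + card (F (b i))} \<subseteq> block i" by (auto simp: block_def)
  qed (use Fn in \<open>auto simp: block_def bS\<close>)
  then obtain \<sigma> where \<sigma>: "\<And>i. bij_betw (\<sigma> i) (block i) (block i)"
      "\<And>i. \<sigma> i ` {b i..<b i + card (F (b i))} = F (b i)" by metis
  define blk where "blk n = (LEAST i. n < b (Suc i))" for n
  define \<pi> where "\<pi> n = \<sigma> (blk n) n" for n
  have blk: "blk n = i" if "n \<in> block i" for n i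
    unfolding blk_def
  proof (rule Least_equality)
    show "n < b (Suc i)" using that by (simp add: block_def)
    fix j assume "n < b (Suc j)"
    then have "b i < b (Suc j)" using that by (simp add: block_def)
    then show "i \<le> j" using sm by (simp add: strict_mono_less)
  qed
  have cover: "n \<in> block (blk n)" for n
  proof -
    have "n < b (Suc n)" using strict_mono_imp_increasing[OF sm, of "Suc n"] by simp
    then have 1: "n < b (Suc (blk n))" unfolding blk_def by (rule LeastI)
    have "b (blk n) \<le> n"
    proof (cases "blk n")
      case (Suc j)
      then have "\<not> n < b (Suc j)" 
        using not_less_Least[of j "\<lambda>i. n < b (Suc i)"] by (simp add: blk_def)
      then show ?thesis using Suc by simp
    qed (simp add: b0)
    with 1 show ?thesis by (simp add: block_def)
  qed
  have "bij_betw \<pi> (block i) (block i)" for i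
    using \<sigma>(1)[of i] by (subst bij_betw_cong[where g = "\<sigma> i"]) (auto simp: \<pi>_def blk)
  moreover have "disjoint_family_on block UNIV"
    using blk unfolding disjoint_family_on_def by blast
  ultimately have "bij_betw \<pi> (\<Union>i. block i) (\<Union>i. block i)"
    by (intro bij_betw_UNION_disjoint) auto
  moreover have "(\<Union>i. block i) = UNIV" using cover by blast
  ultimately have bij: "bij \<pi>" by simp
  then obtain S where S: "(\<lambda>n. \<Sum>k<n. x (\<pi> k)) \<longlonglongrightarrow> S"
    using sum unfolding summable_def sums_def by blast
  then have "(\<lambda>n. p s ((\<Sum>k<n. x (\<pi> k)) - S)) \<longlonglongrightarrow> 0"
    by (simp add: tendsto_iff_seminorms)
  then obtain K where K: "\<And>n. n \<ge> K \<Longrightarrow> p s ((\<Sum>k<n. x (\<pi> k)) - S) < \<epsilon> / 2"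
    using \<epsilon> order_tendstoD(2)[of _ 0 sequentially "\<epsilon>/2"] by (auto simp: eventually_sequentially)
  define m where "m = card (F (b K))"
  have bK: "b K \<ge> K" by (rule strict_mono_imp_increasing[OF sm])
  have "{..<b K + m} = {..<b K} \<union> {b K..<b K + m}" by auto
  then have "(\<Sum>k<b K + m. x (\<pi> k)) = (\<Sum>k<b K. x (\<pi> k)) + (\<Sum>k\<in>{b K..<b K + m}. x (\<pi> k))"
    by (simp add: sum.union_disjoint ivl_disj_int)
  moreover have "(\<Sum>k\<in>{b K..<b K + m}. x (\<pi> k)) = (\<Sum>k\<in>F (b K). x k)"
  proof -
    have img: "\<pi> ` {b K..<b K + m} = F (b K)"
    proof -
      have "m \<le> card (block K)"
        using Fn[of "b K"] unfolding m_def by (intro card_mono) (auto simp: block_def bS)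
      then have "\<pi> ` {b K..<b K + m} = \<sigma> K ` {b K..<b K + m}"
        using blk[of _ K] by (intro image_cong) (auto simp: \<pi>_def block_def)
      then show ?thesis using \<sigma>(2)[of K] by (simp add: m_def)
    qed
    have "inj_on \<pi> {b K..<b K + m}" using bij by (auto simp: bij_def intro: inj_on_subset)
    then show ?thesis using img by (metis (no_types, lifting) sum.reindex_cong)
  qed
  ultimately have "(\<Sum>k\<in>F (b K). x k) = ((\<Sum>k<b K + m. x (\<pi> k)) - S) - ((\<Sum>k<b K. x (\<pi> k)) - S)"
    by simp
  then have "p s (\<Sum>k\<in>F (b K). x k) \<le> p s ((\<Sum>k<b K + m. x (\<pi> k)) - S) + p s ((\<Sum>k<b K. x (\<pi> k)) - S)"
    using p_diff by metis
  also have "\<dots> < \<epsilon> / 2 + \<epsilon> / 2" using bK by (intro add_strict_mono K) auto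
  finally show False using F(3)[of "b K"] by simp
qed

text \<open>
  Continuity of the coordinates is not part of the notion of a Schauder basis; it is proved below as
  \<open>coord_continuous\<close>.
\<close>
locale frechet_basis = frechet_space p for p :: "nat \<Rightarrow> 'a::{real_vector, t2_space} \<Rightarrow> real" +
  fixes e :: "nat \<Rightarrow> 'a"
  assumes basis: "unconditional_schauder_basis e"
begin

lemma coord_sums: "(\<lambda>k. coord e k x *\<^sub>R e k) sums x"
  using basis theI'[of "\<lambda>c. (\<lambda>k. c k *\<^sub>R e k) sums x"]
  unfolding unconditional_schauder_basis_def schauder_basis_def coord_def by blast

lemma coord_unique: "(\<lambda>k. c k *\<^sub>R e k) sums x \<Longrightarrow> coord e k x = c k"
  using basis the1_equality[of "\<lambda>c. (\<lambda>k. c k *\<^sub>R e k) sums x" c]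
  unfolding unconditional_schauder_basis_def schauder_basis_def coord_def by auto

lemma coord_eqI: "(\<And>k. coord e k x = coord e k y) \<Longrightarrow> x = y"
  using coord_sums[of x] coord_sums[of y] sums_unique2 by (metis (no_types, lifting) ext)

lemma coord_add [simp]: "coord e k (x + y) = coord e k x + coord e k y"
proof (rule coord_unique)
  show "(\<lambda>k. (coord e k x + coord e k y) *\<^sub>R e k) sums (x + y)"
    using frechet_tendsto_add[OF coord_sums[of x, unfolded sums_def] coord_sums[of y, unfolded sums_def]]
    by (simp add: sums_def scaleR_left_distrib sum.distrib)
qed

lemma coord_scaleR [simp]: "coord e k (r *\<^sub>R x) = r * coord e k x"
proof (rule coord_unique)
  show "(\<lambda>k. (r * coord e k x) *\<^sub>R e k) sums (r *\<^sub>R x)"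
    using frechet_tendsto_const_scaleR[OF coord_sums[of x, unfolded sums_def], of r]
    by (simp add: sums_def scaleR_sum_right)
qed

lemma coord_minus [simp]: "coord e k (- x) = - coord e k x"
  using coord_scaleR[of k "-1" x] by simp

lemma coord_diff [simp]: "coord e k (x - y) = coord e k x - coord e k y"
  using coord_add[of k x "- y"] by simp

lemma coord_0 [simp]: "coord e k 0 = 0"
  using coord_scaleR[of k 0 0] by simp

lemma coord_sum: "coord e k (sum g A) = (\<Sum>i\<in>A. coord e k (g i))"
  by (induction A rule: infinite_finite_induct) auto

lemma coord_finite_combination:
  assumes "finite F" shows "coord e j (\<Sum>k\<in>F. c k *\<^sub>R e k) = (if j \<in> F then c j else 0)"
proof (rule coord_unique)
  have "(\<lambda>k. (if k \<in> F then c k else 0) *\<^sub>R e k) sums (\<Sum>k\<in>F. (if k \<in> F then c k else 0) *\<^sub>R e k)"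
    using assms by (intro sums_finite) auto
  then show "(\<lambda>k. (if k \<in> F then c k else 0) *\<^sub>R e k) sums (\<Sum>k\<in>F. c k *\<^sub>R e k)" by simp
qed

lemma basis_vector_nonzero: "\<exists>s. p s (e k) > 0"
proof (rule ccontr)
  assume "\<not> ?thesis"
  then have "p s (e k - 0) = 0" for s using p_nonneg[of s "e k"] by (simp add: not_less antisym)
  then have "e k = 0" by (rule eq_if_seminorms_0)
  then show False using coord_finite_combination[of "{k}" k "\<lambda>_. 1"] by simp
qed

text \<open>
  The tails are small uniformly in all coefficient sequences dominated by the coordinates of one
  element. This uniformity reduces convergence in order bounded sets to finitely many coordinates.
\<close>
lemma dominated_tails_small:
  assumes "\<epsilon> > 0"
  shows "\<exists>N. \<forall>F c. finite F \<longrightarrow> F \<subseteq> {N..} \<longrightarrow> (\<forall>k. \<bar>c k\<bar> \<le> \<bar>coord e k x\<bar>)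
           \<longrightarrow> p s (\<Sum>k\<in>F. c k *\<^sub>R e k) < \<epsilon>"
proof -
  have "\<exists>N. \<forall>F. finite F \<longrightarrow> F \<subseteq> {N..} \<longrightarrow> p s (\<Sum>k\<in>F. coord e k x *\<^sub>R e k) < \<epsilon> / 3"
    using basis assms unfolding unconditional_schauder_basis_def
    by (intro permutable_series_small_tails) (auto dest: sums_summable)
  then obtain N where N: "\<And>F. finite F \<Longrightarrow> F \<subseteq> {N..} \<Longrightarrow> p s (\<Sum>k\<in>F. coord e k x *\<^sub>R e k) < \<epsilon> / 3"
    by blast
  have "p s (\<Sum>k\<in>F. c k *\<^sub>R e k) < \<epsilon>"
    if F: "finite F" "F \<subseteq> {N..}" and c: "\<And>k. \<bar>c k\<bar> \<le> \<bar>coord e k x\<bar>" for F c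
  proof -
    have "p s (\<Sum>k\<in>F. (c k / coord e k x) *\<^sub>R (coord e k x *\<^sub>R e k)) \<le> 2 * (\<epsilon> / 3)"
    proof (rule seminorm_solid_sum_le[OF seminorm F(1)])
      show "\<bar>c k / coord e k x\<bar> \<le> 1" for k using c[of k] by (simp add: divide_le_eq)
      show "p s (\<Sum>k\<in>G. coord e k x *\<^sub>R e k) \<le> \<epsilon> / 3" if "G \<subseteq> F" for G
        using N[of G] that F finite_subset by force
    qed
    moreover have "c k / coord e k x * coord e k x = c k" for k using c[of k] by auto
    ultimately show ?thesis using assms by simp
  qed
  then show ?thesis by blast
qed

lemma dominated_element_exists:
  assumes c: "\<And>k. \<bar>c k\<bar> \<le> \<bar>coord e k x\<bar>" shows "\<exists>y. \<forall>k. coord e k y = c k"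
proof -
  have "\<exists>l. (\<lambda>n. \<Sum>k<n. c k *\<^sub>R e k) \<longlonglongrightarrow> l"
  proof (rule complete, intro allI impI)
    fix s and \<epsilon> :: real assume "\<epsilon> > 0"
    then obtain N where N: "\<forall>F c. finite F \<longrightarrow> F \<subseteq> {N..} \<longrightarrow> (\<forall>k. \<bar>c k\<bar> \<le> \<bar>coord e k x\<bar>)
        \<longrightarrow> p s (\<Sum>k\<in>F. c k *\<^sub>R e k) < \<epsilon>"
      using dominated_tails_small[of \<epsilon> x s] by blast
    have *: "p s ((\<Sum>k<n. c k *\<^sub>R e k) - (\<Sum>k<m. c k *\<^sub>R e k)) < \<epsilon>" if "N \<le> m" "m \<le> n" for m n
    proof -
      have "(\<Sum>k<n. c k *\<^sub>R e k) - (\<Sum>k<m. c k *\<^sub>R e k) = (\<Sum>k\<in>{m..<n}. c k *\<^sub>R e k)"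
        using that(2) sum_diff_nat_ivl[of 0 m n "\<lambda>k. c k *\<^sub>R e k"] by (simp add: lessThan_atLeast0)
      then show ?thesis using N[rule_format, of "{m..<n}" c] that c by force
    qed
    have "p s ((\<Sum>k<m. c k *\<^sub>R e k) - (\<Sum>k<n. c k *\<^sub>R e k)) < \<epsilon>" if "N \<le> m" "N \<le> n" for m n
      using *[of m n] *[of n m] that p_minus_commute[of s "\<Sum>k<m. c k *\<^sub>R e k" "\<Sum>k<n. c k *\<^sub>R e k"]
      by (cases "m \<le> n") auto
    then show "\<exists>N. \<forall>m\<ge>N. \<forall>n\<ge>N. p s ((\<Sum>k<m. c k *\<^sub>R e k) - (\<Sum>k<n. c k *\<^sub>R e k)) < \<epsilon>" by blast
  qed
  then obtain y where "(\<lambda>k. c k *\<^sub>R e k) sums y" unfolding sums_def by blast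
  then show ?thesis using coord_unique by blast
qed

lemma between_element_exists:
  assumes "\<And>k. coord e k x \<le> c k" "\<And>k. c k \<le> coord e k y"
  shows "\<exists>z. \<forall>k. coord e k z = c k"
proof -
  have "\<bar>c k - coord e k x\<bar> \<le> \<bar>coord e k (y - x)\<bar>" for k
    using assms(1)[of k] assms(2)[of k] by simp
  then obtain w where "\<forall>k. coord e k w = c k - coord e k x"
    using dominated_element_exists[of "\<lambda>k. c k - coord e k x" "y - x"] by blast
  then have "\<forall>k. coord e k (x + w) = c k" by simp
  then show ?thesis by blast
qed

lemma dominated_tendsto_0:
  assumes dom: "eventually (\<lambda>n. \<forall>k. \<bar>coord e k (u n)\<bar> \<le> \<bar>coord e k x\<bar>) F"
    and lim: "\<And>k. ((\<lambda>n. coord e k (u n)) \<longlongrightarrow> 0) F"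
  shows "(u \<longlongrightarrow> 0) F"
  unfolding tendsto_iff_seminorms
proof (intro allI tendstoI)
  fix s and \<epsilon> :: real assume \<epsilon>: "\<epsilon> > 0"
  then have "\<epsilon> / 2 > 0" by simp
  then obtain N where N: "\<forall>G c. finite G \<longrightarrow> G \<subseteq> {N..} \<longrightarrow> (\<forall>k. \<bar>c k\<bar> \<le> \<bar>coord e k x\<bar>)
      \<longrightarrow> p s (\<Sum>k\<in>G. c k *\<^sub>R e k) < \<epsilon> / 2"
    using dominated_tails_small[of "\<epsilon> / 2" x s] by blast
  have "((\<lambda>n. \<Sum>k<N. coord e k (u n) *\<^sub>R e k) \<longlongrightarrow> (\<Sum>k<N. 0 *\<^sub>R e k)) F"
    by (intro frechet_tendsto_sum frechet_tendsto_scaleR lim)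
  then have "((\<lambda>n. p s (\<Sum>k<N. coord e k (u n) *\<^sub>R e k)) \<longlongrightarrow> 0) F"
    using tendsto_seminorm[of _ 0 F s] by (simp add: p_zero)
  then have "eventually (\<lambda>n. p s (\<Sum>k<N. coord e k (u n) *\<^sub>R e k) < \<epsilon> / 2) F"
    using \<epsilon> by (intro order_tendstoD) auto
  with dom show "eventually (\<lambda>n. dist (p s (u n - 0)) 0 < \<epsilon>) F"
  proof eventually_elim
    fix n
    assume d: "\<forall>k. \<bar>coord e k (u n)\<bar> \<le> \<bar>coord e k x\<bar>"
      and h: "p s (\<Sum>k<N. coord e k (u n) *\<^sub>R e k) < \<epsilon> / 2"
    let ?S = "\<lambda>m. \<Sum>k<m. coord e k (u n) *\<^sub>R e k"
    have "(\<lambda>m. p s (?S m - ?S N)) \<longlonglongrightarrow> p s (u n - ?S N)"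
      using coord_sums[of "u n"] unfolding sums_def
      by (intro tendsto_seminorm frechet_tendsto_diff) auto
    moreover have "p s (?S m - ?S N) \<le> \<epsilon> / 2" if "m \<ge> N" for m
    proof -
      have "?S m - ?S N = (\<Sum>k\<in>{N..<m}. coord e k (u n) *\<^sub>R e k)"
        using that sum_diff_nat_ivl[of 0 N m "\<lambda>k. coord e k (u n) *\<^sub>R e k"]
        by (simp add: lessThan_atLeast0)
      then show ?thesis using N[rule_format, of "{N..<m}" "\<lambda>k. coord e k (u n)"] d by force
    qed
    ultimately have "p s (u n - ?S N) \<le> \<epsilon> / 2" by (intro LIMSEQ_le_const2) auto
    then show "dist (p s (u n - 0)) 0 < \<epsilon>"
      using h p_add[of s "u n - ?S N" "?S N"] by (simp add: p_nonneg)
  qed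
qed

lemma order_bounded_tendsto:
  assumes bnd: "eventually (\<lambda>n. coord_le e a (u n) \<and> coord_le e (u n) b) F"
    and l: "coord_le e a l" "coord_le e l b"
    and lim: "\<And>k. ((\<lambda>n. coord e k (u n)) \<longlongrightarrow> coord e k l) F"
  shows "(u \<longlongrightarrow> l) F"
proof -
  have "((\<lambda>n. u n - l) \<longlongrightarrow> 0) F"
  proof (rule dominated_tendsto_0)
    show "eventually (\<lambda>n. \<forall>k. \<bar>coord e k (u n - l)\<bar> \<le> \<bar>coord e k (b - a)\<bar>) F"
      using bnd
    proof eventually_elim
      case (elim n)
      show ?case
      proof
        fix k
        have "coord e k a \<le> coord e k (u n)" "coord e k (u n) \<le> coord e k b"
          "coord e k a \<le> coord e k l" "coord e k l \<le> coord e k b"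
          using elim l by (auto simp: coord_le_def)
        then show "\<bar>coord e k (u n - l)\<bar> \<le> \<bar>coord e k (b - a)\<bar>" by simp
      qed
    qed
    show "((\<lambda>n. coord e k (u n - l)) \<longlongrightarrow> 0) F" for k
      using lim[of k] by (simp add: LIM_zero)
  qed
  then show ?thesis by (simp add: tendsto_iff_seminorms)
qed

text \<open>
  The smallest seminorm above \<open>p s\<close> that is monotone in the absolute values of the coordinates.
\<close>
definition solid :: "nat \<Rightarrow> 'a \<Rightarrow> real" where
  "solid s x = (SUP (F, c)\<in>{(F, c). finite F \<and> (\<forall>k. \<bar>c k\<bar> \<le> 1)}.
     p s (\<Sum>k\<in>F. (c k * coord e k x) *\<^sub>R e k))"

lemma solid_bdd:
  "bdd_above ((\<lambda>(F, c). p s (\<Sum>k\<in>F. (c k * coord e k x) *\<^sub>R e k)) `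
     {(F, c). finite F \<and> (\<forall>k. \<bar>c k\<bar> \<le> 1)})"
proof -
  obtain N where N: "\<forall>G c. finite G \<longrightarrow> G \<subseteq> {N..} \<longrightarrow> (\<forall>k. \<bar>c k\<bar> \<le> \<bar>coord e k x\<bar>)
      \<longrightarrow> p s (\<Sum>k\<in>G. c k *\<^sub>R e k) < 1"
    using dominated_tails_small[of 1 x s] zero_less_one by blast
  have "p s (\<Sum>k\<in>F. (c k * coord e k x) *\<^sub>R e k) \<le> (\<Sum>k<N. \<bar>coord e k x\<bar> * p s (e k)) + 1"
    if F: "finite F" and c: "\<And>k. \<bar>c k\<bar> \<le> 1" for F c
  proof -
    have le: "\<bar>c k * coord e k x\<bar> \<le> \<bar>coord e k x\<bar>" for k
      using mult_right_mono[OF c[of k], of "\<bar>coord e k x\<bar>"] by (simp add: abs_mult)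
    have "p s (\<Sum>k\<in>F \<inter> {..<N}. (c k * coord e k x) *\<^sub>R e k)
        \<le> (\<Sum>k\<in>F \<inter> {..<N}. p s ((c k * coord e k x) *\<^sub>R e k))"
      by (rule p_sum)
    also have "\<dots> \<le> (\<Sum>k\<in>F \<inter> {..<N}. \<bar>coord e k x\<bar> * p s (e k))"
      by (intro sum_mono) (use le in \<open>auto simp: p_scaleR p_nonneg intro!: mult_right_mono\<close>)
    also have "\<dots> \<le> (\<Sum>k<N. \<bar>coord e k x\<bar> * p s (e k))"
      by (intro sum_mono2) (auto simp: p_nonneg)
    finally have 1: "p s (\<Sum>k\<in>F \<inter> {..<N}. (c k * coord e k x) *\<^sub>R e k)
        \<le> (\<Sum>k<N. \<bar>coord e k x\<bar> * p s (e k))" .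
    have 2: "p s (\<Sum>k\<in>F - {..<N}. (c k * coord e k x) *\<^sub>R e k) < 1"
      using F le by (intro N[rule_format]) auto
    have "(\<Sum>k\<in>F. (c k * coord e k x) *\<^sub>R e k)
       = (\<Sum>k\<in>F \<inter> {..<N}. (c k * coord e k x) *\<^sub>R e k) + (\<Sum>k\<in>F - {..<N}. (c k * coord e k x) *\<^sub>R e k)"
      by (rule sum.Int_Diff[OF F])
    then have "p s (\<Sum>k\<in>F. (c k * coord e k x) *\<^sub>R e k)
       \<le> p s (\<Sum>k\<in>F \<inter> {..<N}. (c k * coord e k x) *\<^sub>R e k) + p s (\<Sum>k\<in>F - {..<N}. (c k * coord e k x) *\<^sub>R e k)"
      by (simp add: p_add)
    with 1 2 show ?thesis by linarith
  qed
  then show ?thesis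
    by (intro bdd_aboveI[of _ "(\<Sum>k<N. \<bar>coord e k x\<bar> * p s (e k)) + 1"]) auto
qed

lemma solid_upper:
  assumes "finite F" "\<And>k. \<bar>c k\<bar> \<le> 1"
  shows "p s (\<Sum>k\<in>F. (c k * coord e k x) *\<^sub>R e k) \<le> solid s x"
  unfolding solid_def by (rule cSUP_upper2[OF solid_bdd, of "(F, c)"]) (use assms in auto)

lemma solid_least:
  assumes "\<And>F c. finite F \<Longrightarrow> (\<And>k. \<bar>c k\<bar> \<le> 1) \<Longrightarrow> p s (\<Sum>k\<in>F. (c k * coord e k x) *\<^sub>R e k) \<le> B"
  shows "solid s x \<le> B"
  unfolding solid_def by (rule cSUP_least) (use assms in \<open>auto intro!: exI[of _ "\<lambda>_. 0"]\<close>)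

lemma seminorm_solid: "seminorm (solid s)"
  unfolding solid_def
proof (rule seminorm_SUP)
  show "{(F::nat set, c::nat \<Rightarrow> real). finite F \<and> (\<forall>k. \<bar>c k\<bar> \<le> 1)} \<noteq> {}"
    by (auto intro!: exI[of _ "\<lambda>_. 0"])
  show "bdd_above ((\<lambda>i. case i of (F, c) \<Rightarrow> p s (\<Sum>k\<in>F. (c k * coord e k x) *\<^sub>R e k)) `
         {(F, c). finite F \<and> (\<forall>k. \<bar>c k\<bar> \<le> 1)})" for x
    by (rule solid_bdd)
  fix i :: "nat set \<times> (nat \<Rightarrow> real)"
  obtain F c where i: "i = (F, c)" by (cases i)
  have "p s (\<Sum>k\<in>F. (c k * coord e k (x + y)) *\<^sub>R e k)
      \<le> p s (\<Sum>k\<in>F. (c k * coord e k x) *\<^sub>R e k) + p s (\<Sum>k\<in>F. (c k * coord e k y) *\<^sub>R e k)" for x y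
    using p_add by (simp add: distrib_left scaleR_left_distrib sum.distrib)
  moreover have "p s (\<Sum>k\<in>F. (c k * coord e k (r *\<^sub>R x)) *\<^sub>R e k)
      = \<bar>r\<bar> * p s (\<Sum>k\<in>F. (c k * coord e k x) *\<^sub>R e k)" for r x
    unfolding p_scaleR[symmetric] by (simp add: scaleR_sum_right mult.left_commute)
  ultimately show "seminorm (\<lambda>x. case i of (F, c) \<Rightarrow> p s (\<Sum>k\<in>F. (c k * coord e k x) *\<^sub>R e k))"
    unfolding seminorm_def i by simp
qed

lemma solid_mono:
  assumes "\<And>k. \<bar>coord e k x\<bar> \<le> \<bar>coord e k y\<bar>" shows "solid s x \<le> solid s y"
proof (rule solid_least)
  fix F c assume F: "finite (F::nat set)" and c: "\<And>k::nat. \<bar>c k\<bar> \<le> (1::real)"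
  define d where "d k = c k * (coord e k x / coord e k y)" for k
  have "\<bar>coord e k x / coord e k y\<bar> \<le> 1" for k using assms[of k] by (simp add: divide_le_eq)
  then have d: "\<bar>d k\<bar> \<le> 1" for k
    unfolding d_def abs_mult using c[of k] by (intro mult_le_one) auto
  have "d k * coord e k y = c k * coord e k x" for k
    using assms[of k] by (auto simp: d_def)
  then show "p s (\<Sum>k\<in>F. (c k * coord e k x) *\<^sub>R e k) \<le> solid s y"
    using solid_upper[OF F, of d s y] d by simp
qed

lemma seminorm_le_solid: "p s x \<le> solid s x"
proof (rule LIMSEQ_le_const2)
  show "(\<lambda>n. p s (\<Sum>k<n. coord e k x *\<^sub>R e k)) \<longlonglongrightarrow> p s x"
    using coord_sums[of x] unfolding sums_def by (rule tendsto_seminorm)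
  show "\<exists>N. \<forall>n\<ge>N. p s (\<Sum>k<n. coord e k x *\<^sub>R e k) \<le> solid s x"
    using solid_upper[of "{..<_}" "\<lambda>_. 1" s x] by auto
qed

lemma coord_le_solid: "\<bar>coord e k x\<bar> * p s (e k) \<le> solid s x"
  using solid_upper[of "{k}" "\<lambda>_. 1" s x] by (simp add: p_scaleR)

text \<open>
  The coordinates of a Cauchy sequence for the solid seminorms converge, to \<open>c\<close> say, uniformly over all
  finite combinations (\<open>unif\<close>). This uniformity allows the exchange of limits which shows that
  \<open>\<Sum> c k e k\<close> converges to the limit \<open>x\<close> of the sequence; uniqueness of the expansion gives
  \<open>coord e k x = c k\<close>, and \<open>unif\<close> becomes convergence in the solid seminorms.
\<close>
lemma solid_compatible:
  assumes cauchy: "\<And>s. \<forall>\<epsilon>>0. \<exists>N. \<forall>m\<ge>N. \<forall>n\<ge>N. solid s (X m - X n) < \<epsilon>" and X: "X \<longlonglongrightarrow> x"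
  shows "(\<lambda>n. solid s (X n - x)) \<longlonglongrightarrow> 0"
proof -
  have "\<exists>c. (\<lambda>n. coord e k (X n)) \<longlonglongrightarrow> c" for k
  proof -
    obtain t where t: "p t (e k) > 0" using basis_vector_nonzero by blast
    have "Cauchy (\<lambda>n. coord e k (X n))"
      unfolding Cauchy_def
    proof (intro allI impI)
      fix \<epsilon> :: real assume "\<epsilon> > 0"
      then obtain N where N: "\<And>m n. m \<ge> N \<Longrightarrow> n \<ge> N \<Longrightarrow> solid t (X m - X n) < \<epsilon> * p t (e k)"
        using cauchy[of t] t by (meson mult_pos_pos)
      have "dist (coord e k (X m)) (coord e k (X n)) < \<epsilon>" if "m \<ge> N" "n \<ge> N" for m n
      proof -
        have "\<bar>coord e k (X m - X n)\<bar> * p t (e k) < \<epsilon> * p t (e k)"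
          using coord_le_solid[of k "X m - X n" t] N[OF that] by linarith
        then show ?thesis using t by (simp add: dist_real_def)
      qed
      then show "\<exists>N. \<forall>m\<ge>N. \<forall>n\<ge>N. dist (coord e k (X m)) (coord e k (X n)) < \<epsilon>" by blast
    qed
    then show ?thesis by (simp add: Cauchy_convergent_iff convergent_def)
  qed
  then obtain c where c: "\<And>k. (\<lambda>n. coord e k (X n)) \<longlonglongrightarrow> c k" by metis
  have unif: "\<exists>N. \<forall>n\<ge>N. \<forall>F d. finite F \<longrightarrow> (\<forall>k. \<bar>d k\<bar> \<le> 1) \<longrightarrow>
      p s (\<Sum>k\<in>F. (d k * (coord e k (X n) - c k)) *\<^sub>R e k) \<le> \<epsilon>" if \<epsilon>: "\<epsilon> > 0" for s \<epsilon>
  proof -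
    obtain N where N: "\<And>m n. m \<ge> N \<Longrightarrow> n \<ge> N \<Longrightarrow> solid s (X m - X n) < \<epsilon>"
      using cauchy[of s] \<epsilon> by meson
    have "p s (\<Sum>k\<in>F. (d k * (coord e k (X n) - c k)) *\<^sub>R e k) \<le> \<epsilon>"
      if "n \<ge> N" "finite F" "\<And>k. \<bar>d k\<bar> \<le> 1" for n F and d :: "nat \<Rightarrow> real"
    proof (rule LIMSEQ_le_const2)
      show "(\<lambda>m. p s (\<Sum>k\<in>F. (d k * (coord e k (X n) - coord e k (X m))) *\<^sub>R e k))
          \<longlonglongrightarrow> p s (\<Sum>k\<in>F. (d k * (coord e k (X n) - c k)) *\<^sub>R e k)"
        by (intro tendsto_seminorm frechet_tendsto_sum frechet_tendsto_scaleR tendsto_intros c)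
      have "p s (\<Sum>k\<in>F. (d k * (coord e k (X n) - coord e k (X m))) *\<^sub>R e k) \<le> \<epsilon>" if "m \<ge> N" for m
        using solid_upper[OF \<open>finite F\<close>, of d s "X n - X m"] \<open>\<And>k. \<bar>d k\<bar> \<le> 1\<close> N[OF \<open>n \<ge> N\<close> that] by simp
      then show "\<exists>N. \<forall>m\<ge>N. p s (\<Sum>k\<in>F. (d k * (coord e k (X n) - coord e k (X m))) *\<^sub>R e k) \<le> \<epsilon>"
        by blast
    qed
    then show ?thesis by blast
  qed
  have "(\<lambda>k. c k *\<^sub>R e k) sums x"
    unfolding sums_def tendsto_iff_seminorms
  proof (intro allI tendstoI)
    fix s and \<epsilon> :: real assume \<epsilon>: "\<epsilon> > 0"
    have "\<epsilon> / 4 > 0" using \<epsilon> by simp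
    then obtain N where N: "\<forall>n\<ge>N. \<forall>F d. finite F \<longrightarrow> (\<forall>k. \<bar>d k\<bar> \<le> 1) \<longrightarrow>
       p s (\<Sum>k\<in>F. (d k * (coord e k (X n) - c k)) *\<^sub>R e k) \<le> \<epsilon> / 4"
      using unif[of "\<epsilon> / 4" s] by blast
    have "(\<lambda>n. p s (X n - x)) \<longlonglongrightarrow> 0" using X tendsto_iff_seminorms by blast
    then have "eventually (\<lambda>n. p s (X n - x) < \<epsilon> / 4) sequentially"
      using \<open>\<epsilon> / 4 > 0\<close> by (rule order_tendstoD)
    then have "eventually (\<lambda>n. n \<ge> N \<and> p s (X n - x) < \<epsilon> / 4) sequentially"
      by (intro eventually_conj eventually_ge_at_top)
    then obtain n where n: "n \<ge> N" "p s (X n - x) < \<epsilon> / 4"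
      using eventually_happens'[OF sequentially_bot] by blast
    have "(\<lambda>m. p s ((\<Sum>k<m. coord e k (X n) *\<^sub>R e k) - X n)) \<longlonglongrightarrow> 0"
      using coord_sums[of "X n"] unfolding sums_def tendsto_iff_seminorms by blast
    then have "eventually (\<lambda>m. p s ((\<Sum>k<m. coord e k (X n) *\<^sub>R e k) - X n) < \<epsilon> / 4) sequentially"
      using \<open>\<epsilon> / 4 > 0\<close> by (rule order_tendstoD)
    then show "eventually (\<lambda>m. dist (p s ((\<Sum>k<m. c k *\<^sub>R e k) - x)) 0 < \<epsilon>) sequentially"
    proof eventually_elim
      case (elim m)
      have "p s ((\<Sum>k<m. coord e k (X n) *\<^sub>R e k) - (\<Sum>k<m. c k *\<^sub>R e k)) \<le> \<epsilon> / 4"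
        using N[rule_format, OF n(1), of "{..<m}" "\<lambda>_. 1"] by (simp add: scaleR_left_diff_distrib sum_subtractf)
      then have "p s ((\<Sum>k<m. c k *\<^sub>R e k) - x) \<le> \<epsilon> / 4 + \<epsilon> / 4 + \<epsilon> / 4"
        using elim n(2) p_triangle[of s "\<Sum>k<m. c k *\<^sub>R e k" x "X n"]
          p_triangle[of s "\<Sum>k<m. c k *\<^sub>R e k" "X n" "\<Sum>k<m. coord e k (X n) *\<^sub>R e k"]
          p_minus_commute[of s "\<Sum>k<m. c k *\<^sub>R e k" "\<Sum>k<m. coord e k (X n) *\<^sub>R e k"] by linarith
      then show ?case using \<epsilon> by (simp add: p_nonneg)
    qed
  qed
  then have cx: "coord e k x = c k" for k by (rule coord_unique)
  show ?thesis
  proof (rule tendstoI)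
    fix \<epsilon> :: real assume \<epsilon>: "\<epsilon> > 0"
    have "\<epsilon> / 2 > 0" using \<epsilon> by simp
    then obtain N where N: "\<forall>n\<ge>N. \<forall>F d. finite F \<longrightarrow> (\<forall>k. \<bar>d k\<bar> \<le> 1) \<longrightarrow>
       p s (\<Sum>k\<in>F. (d k * (coord e k (X n) - c k)) *\<^sub>R e k) \<le> \<epsilon> / 2"
      using unif[of "\<epsilon> / 2" s] by blast
    have "solid s (X n - x) \<le> \<epsilon> / 2" if "n \<ge> N" for n
      by (rule solid_least) (use N[rule_format, OF that] cx in auto)
    then have "dist (solid s (X n - x)) 0 < \<epsilon>" if "n \<ge> N" for n
      using that \<epsilon> seminorm_nonneg[OF seminorm_solid, of s "X n - x"] by force
    then show "eventually (\<lambda>n. dist (solid s (X n - x)) 0 < \<epsilon>) sequentially"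
      by (auto simp: eventually_sequentially)
  qed
qed

lemma solid_continuous: "\<exists>n M. \<forall>x. solid s x \<le> M * (\<Sum>i\<le>n. p i x)"
  by (rule finer_complete_seminorms_continuous[OF seminorm_solid solid_compatible])

lemma coord_continuous: "\<exists>n M. \<forall>x. \<bar>coord e k x\<bar> \<le> M * (\<Sum>i\<le>n. p i x)"
proof -
  obtain s where s: "p s (e k) > 0" using basis_vector_nonzero by blast
  obtain n M where M: "\<And>x. solid s x \<le> M * (\<Sum>i\<le>n. p i x)" using solid_continuous by blast
  have "\<bar>coord e k x\<bar> \<le> (M / p s (e k)) * (\<Sum>i\<le>n. p i x)" for x
    using order_trans[OF coord_le_solid M] s by (simp add: field_simps)
  then show ?thesis by blast
qed

lemma tendsto_coord:
  assumes "(X \<longlongrightarrow> x) F" shows "((\<lambda>n. coord e k (X n)) \<longlongrightarrow> coord e k x) F"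
proof -
  obtain n M where M: "\<And>x. \<bar>coord e k x\<bar> \<le> M * (\<Sum>i\<le>n. p i x)" using coord_continuous by blast
  have "((\<lambda>j. M * (\<Sum>i\<le>n. p i (X j - x))) \<longlongrightarrow> M * (\<Sum>i\<le>n. 0)) F"
    using assms unfolding tendsto_iff_seminorms by (intro tendsto_mult_left tendsto_sum) auto
  then have "((\<lambda>j. M * (\<Sum>i\<le>n. p i (X j - x))) \<longlongrightarrow> 0) F" by simp
  then have "((\<lambda>j. coord e k (X j) - coord e k x) \<longlongrightarrow> 0) F"
    by (rule Lim_null_comparison[rotated]) (use M[of "X _ - x"] in auto)
  then show ?thesis by (simp add: LIM_zero_iff)
qed

end

section \<open>Integration\<close>

lemma complete_measure_lebesgue_on: 
  assumes "S \<in> sets lebesgue" shows "complete_measure (lebesgue_on S)"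
proof
  fix A B assume AB: "B \<subseteq> A" "A \<in> null_sets (lebesgue_on S)"
  then have "A \<subseteq> S" "A \<in> null_sets lebesgue" using assms by (auto simp: null_sets_restrict_space)
  then have "B \<in> sets lebesgue" using AB(1) completion.complete by blast
  then show "B \<in> sets (lebesgue_on S)"
    using AB(1) \<open>A \<subseteq> S\<close> assms by (auto simp: sets_restrict_space_iff)
qed

lemma (in complete_measure) borel_measurable_AE_eq:
  fixes f g :: "_ \<Rightarrow> real"
  assumes "f \<in> borel_measurable M" "AE x in M. f x = g x" shows "g \<in> borel_measurable M"
proof (rule measurableI)
  fix A :: "real set" assume A: "A \<in> sets borel"
  show "g -` A \<inter> space M \<in> sets M"
  proof (rule in_sets_AE)
    show "AE x in M. x \<in> f -` A \<inter> space M \<longleftrightarrow> x \<in> g -` A \<inter> space M"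
      using assms(2) by eventually_elim auto
    show "f -` A \<inter> space M \<in> sets M" using assms(1) A by (rule measurable_sets)
  qed auto
qed auto

text \<open>
  By Fatou's lemma the almost everywhere limit of a sequence that is Cauchy in \<open>L\<^sup>1\<close> is also its limit in
  \<open>L\<^sup>1\<close>. Completeness of the measure makes the limit measurable, although convergence holds only almost
  everywhere.
\<close>
lemma L1_cauchy_AE_limit:
  fixes u :: "nat \<Rightarrow> 'b \<Rightarrow> real"
  assumes M: "complete_measure M" and u: "\<And>n. integrable M (u n)"
    and lim: "AE x in M. (\<lambda>n. u n x) \<longlonglongrightarrow> v x"
    and cauchy: "\<And>\<epsilon>. \<epsilon> > 0 \<Longrightarrow> \<exists>N. \<forall>n\<ge>N. \<forall>m\<ge>N. (\<integral>x. \<bar>u n x - u m x\<bar> \<partial>M) < \<epsilon>"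
  shows "integrable M v" and "(\<lambda>n. \<integral>x. u n x \<partial>M) \<longlonglongrightarrow> (\<integral>x. v x \<partial>M)"
proof -
  have [measurable]: "u n \<in> borel_measurable M" for n using u by auto
  have "(\<lambda>x. lim (\<lambda>n. u n x)) \<in> borel_measurable M" by measurable
  moreover have "AE x in M. lim (\<lambda>n. u n x) = v x" using lim by eventually_elim (rule limI)
  ultimately have [measurable]: "v \<in> borel_measurable M"
    by (rule complete_measure.borel_measurable_AE_eq[OF M])
  have near: "\<exists>N. \<forall>n\<ge>N. (\<integral>\<^sup>+x. ennreal \<bar>u n x - v x\<bar> \<partial>M) \<le> ennreal \<epsilon>" if \<epsilon>: "\<epsilon> > 0" for \<epsilon>
  proof -
    obtain N where N: "\<And>n m. n \<ge> N \<Longrightarrow> m \<ge> N \<Longrightarrow> (\<integral>x. \<bar>u n x - u m x\<bar> \<partial>M) < \<epsilon>"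
      using cauchy[OF \<epsilon>] by blast
    have "(\<integral>\<^sup>+x. ennreal \<bar>u n x - v x\<bar> \<partial>M) \<le> ennreal \<epsilon>" if n: "n \<ge> N" for n
    proof -
      have "(\<integral>\<^sup>+x. ennreal \<bar>u n x - v x\<bar> \<partial>M) = (\<integral>\<^sup>+x. liminf (\<lambda>m. ennreal \<bar>u n x - u m x\<bar>) \<partial>M)"
      proof (rule nn_integral_cong_AE)
        show "AE x in M. ennreal \<bar>u n x - v x\<bar> = liminf (\<lambda>m. ennreal \<bar>u n x - u m x\<bar>)"
          using lim
        proof eventually_elim
          case (elim x)
          then have "(\<lambda>m. ennreal \<bar>u n x - u m x\<bar>) \<longlonglongrightarrow> ennreal \<bar>u n x - v x\<bar>"
            by (intro tendsto_intros)
          then show ?case by (rule lim_imp_Liminf[OF sequentially_bot, symmetric])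
        qed
      qed
      also have "\<dots> \<le> liminf (\<lambda>m. \<integral>\<^sup>+x. ennreal \<bar>u n x - u m x\<bar> \<partial>M)"
        by (rule nn_integral_liminf) measurable
      also have "\<dots> \<le> limsup (\<lambda>m. \<integral>\<^sup>+x. ennreal \<bar>u n x - u m x\<bar> \<partial>M)"
        by (rule Liminf_le_Limsup) simp
      also have "\<dots> \<le> ennreal \<epsilon>"
      proof (rule Limsup_bounded)
        have "(\<integral>\<^sup>+x. ennreal \<bar>u n x - u m x\<bar> \<partial>M) \<le> ennreal \<epsilon>" if "m \<ge> N" for m
          using N[OF n that] u by (subst nn_integral_eq_integral) (auto intro!: ennreal_leI)
        then show "eventually (\<lambda>m. (\<integral>\<^sup>+x. ennreal \<bar>u n x - u m x\<bar> \<partial>M) \<le> ennreal \<epsilon>) sequentially"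
          by (auto simp: eventually_sequentially)
      qed
      finally show ?thesis .
    qed
    then show ?thesis by blast
  qed
  obtain N where "(\<integral>\<^sup>+x. ennreal \<bar>u N x - v x\<bar> \<partial>M) \<le> ennreal 1" using near[of 1] by auto
  then have "integrable M (\<lambda>x. u N x - v x)"
    by (intro integrableI_bounded) (auto intro: le_less_trans)
  then have "integrable M (\<lambda>x. u N x - (u N x - v x))" by (rule Bochner_Integration.integrable_diff[OF u])
  moreover have "(\<lambda>x. u N x - (u N x - v x)) = v" by (rule ext) simp
  ultimately show v: "integrable M v" by metis
  show "(\<lambda>n. \<integral>x. u n x \<partial>M) \<longlonglongrightarrow> (\<integral>x. v x \<partial>M)"
  proof (rule LIMSEQ_I)
    fix r :: real assume r: "r > 0"
    obtain N where N: "\<And>n. n \<ge> N \<Longrightarrow> (\<integral>\<^sup>+x. ennreal \<bar>u n x - v x\<bar> \<partial>M) \<le> ennreal (r / 2)"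
      using near[of "r/2"] r by auto
    have "norm ((\<integral>x. u n x \<partial>M) - (\<integral>x. v x \<partial>M)) < r" if "n \<ge> N" for n
    proof -
      have "ennreal (\<integral>x. \<bar>u n x - v x\<bar> \<partial>M) \<le> ennreal (r / 2)"
        using N[OF that] u v by (subst (asm) nn_integral_eq_integral) auto
      then have "(\<integral>x. \<bar>u n x - v x\<bar> \<partial>M) \<le> r / 2" using r by (simp add: ennreal_le_iff)
      moreover have "\<bar>(\<integral>x. u n x - v x \<partial>M)\<bar> \<le> (\<integral>x. \<bar>u n x - v x\<bar> \<partial>M)"
        by (rule integral_abs_bound)
      moreover have "(\<integral>x. u n x - v x \<partial>M) = (\<integral>x. u n x \<partial>M) - (\<integral>x. v x \<partial>M)"
        using u v by (intro Bochner_Integration.integral_diff)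
      ultimately show ?thesis using r by simp
    qed
    then show "\<exists>N. \<forall>n\<ge>N. norm ((\<integral>x. u n x \<partial>M) - (\<integral>x. v x \<partial>M)) < r" by blast
  qed
qed

lemma integrable_const_lebesgue_on: "integrable (lebesgue_on {a..b::real}) (\<lambda>t. c::real)"
  using finite_measure.integrable_const[OF finite_measure_lebesgue_on[of "{a..b}"]] by simp

lemma step_function_iff_simple_function:
  "step_function a b h \<longleftrightarrow> simple_function (lebesgue_on {a..b}) h"
proof -
  have eq: "h -` {c} \<inter> {a..b} = {t\<in>{a..b}. h t = c}" for c by auto
  have "{t\<in>{a..b}. h t = c} = {}" if "c \<notin> h ` {a..b}" for c using that by auto
  then have "(\<forall>c. {t\<in>{a..b}. h t = c} \<in> sets lebesgue)
      \<longleftrightarrow> (\<forall>c\<in>h ` {a..b}. {t\<in>{a..b}. h t = c} \<in> sets lebesgue)"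
    by (metis (no_types, lifting) sets.empty_sets)
  then show ?thesis
    unfolding step_function_def simple_function_def space_lebesgue_on eq
    by (auto simp: sets_restrict_space_iff)
qed

lemma step_function_lebesgue_integral:
  fixes \<phi> :: "'a \<Rightarrow> real"
  assumes h: "step_function a b h"
  shows "integrable (lebesgue_on {a..b}) (\<lambda>t. \<phi> (h t))"
    and "(\<integral>t. \<phi> (h t) \<partial>lebesgue_on {a..b}) =
      (\<Sum>c\<in>h ` {a..b}. measure lebesgue {t\<in>{a..b}. h t = c} * \<phi> c)"
proof -
  define A where "A c = {t\<in>{a..b}. h t = c}" for c
  have fin: "finite (h ` {a..b})" and A: "A c \<in> sets lebesgue" for c
    using h by (auto simp: step_function_def A_def)
  have A': "A c \<in> sets (lebesgue_on {a..b})" for c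
    using A[of c] by (auto simp: sets_restrict_space_iff A_def)
  interpret F: finite_measure "lebesgue_on {a..b}" by (rule finite_measure_lebesgue_on) simp
  have rep: "\<phi> (h t) = (\<Sum>c\<in>h ` {a..b}. indicator (A c) t * \<phi> c)" if "t \<in> {a..b}" for t
  proof -
    have "(\<Sum>c\<in>h ` {a..b}. indicator (A c) t * \<phi> c) = (\<Sum>c\<in>h ` {a..b}. if c = h t then \<phi> c else 0)"
      using that by (intro sum.cong) (auto simp: A_def)
    also have "\<dots> = \<phi> (h t)" using that fin by (subst sum.delta) auto
    finally show ?thesis by simp
  qed
  have int: "integrable (lebesgue_on {a..b}) (\<lambda>t. indicator (A c) t * \<phi> c)" for c
    using A'[of c] by (intro integrable_mult_left integrable_real_indicator) (auto simp: less_top[symmetric])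
  then have "integrable (lebesgue_on {a..b}) (\<lambda>t. \<Sum>c\<in>h ` {a..b}. indicator (A c) t * \<phi> c)"
    by (intro Bochner_Integration.integrable_sum)
  then show "integrable (lebesgue_on {a..b}) (\<lambda>t. \<phi> (h t))"
    by (subst Bochner_Integration.integrable_cong[OF refl rep]) auto
  have "(\<integral>t. \<phi> (h t) \<partial>lebesgue_on {a..b}) = (\<integral>t. (\<Sum>c\<in>h ` {a..b}. indicator (A c) t * \<phi> c) \<partial>lebesgue_on {a..b})"
    by (rule Bochner_Integration.integral_cong) (use rep in auto)
  also have "\<dots> = (\<Sum>c\<in>h ` {a..b}. \<integral>t. indicator (A c) t * \<phi> c \<partial>lebesgue_on {a..b})"
    using int by (rule Bochner_Integration.integral_sum)
  also have "\<dots> = (\<Sum>c\<in>h ` {a..b}. measure lebesgue (A c) * \<phi> c)"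
  proof (rule sum.cong[OF refl])
    fix c
    have "A c \<subseteq> {a..b}" by (auto simp: A_def)
    then have "measure (lebesgue_on {a..b}) (A c) = measure lebesgue (A c)"
      by (intro measure_restrict_space) auto
    moreover have "A c \<inter> {a..b} = A c" by (auto simp: A_def)
    ultimately show "(\<integral>t. indicator (A c) t * \<phi> c \<partial>lebesgue_on {a..b}) = measure lebesgue (A c) * \<phi> c"
      by simp
  qed
  finally show "(\<integral>t. \<phi> (h t) \<partial>lebesgue_on {a..b}) =
      (\<Sum>c\<in>h ` {a..b}. measure lebesgue {t\<in>{a..b}. h t = c} * \<phi> c)" by (simp add: A_def)
qed

lemma step_function_diff: "step_function a b h \<Longrightarrow> step_function a b h' \<Longrightarrow> step_function a b (\<lambda>t. h t - h' t)"
  unfolding step_function_iff_simple_function by (rule simple_function_compose2)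

context frechet_space
begin

text \<open>
  Every functional that is Lipschitz for the seminorms carries an approximation by step functions to
  an \<open>L\<^sup>1\<close>-Cauchy sequence of real functions. It is applied to the coordinates and to the seminorms
  themselves.
\<close>
lemma step_approximation_lipschitz:
  assumes app: "step_approximation p a b g h"
    and \<phi>: "\<And>x y. \<bar>\<phi> x - \<phi> y\<bar> \<le> M * (\<Sum>i\<le>n. p i (x - y))"
  shows "integrable (lebesgue_on {a..b}) (\<lambda>t. \<phi> (g t))"
    and "(\<lambda>j. \<integral>t. \<phi> (h j t) \<partial>lebesgue_on {a..b}) \<longlonglongrightarrow> (\<integral>t. \<phi> (g t) \<partial>lebesgue_on {a..b})"
proof -
  let ?L = "lebesgue_on {a..b}"
  have h: "step_function a b (h j)" for j using app by (simp add: step_approximation_def)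
  have hd: "step_function a b (\<lambda>t. h j t - h l t)" for j l by (intro step_function_diff h)
  have int: "integrable ?L (\<lambda>t. \<phi> (h j t))" for j by (rule step_function_lebesgue_integral[OF h])
  have intp: "integrable ?L (\<lambda>t. p s (h j t - h l t))" for s j l
    by (rule step_function_lebesgue_integral[OF hd])
  have ae: "AE t in ?L. (\<lambda>j. \<phi> (h j t)) \<longlonglongrightarrow> \<phi> (g t)"
  proof -
    have "AE t in ?L. (\<lambda>j. h j t) \<longlonglongrightarrow> g t" using app by (simp add: step_approximation_def)
    then show ?thesis
    proof eventually_elim
      fix t assume "(\<lambda>j. h j t) \<longlonglongrightarrow> g t"
      then have "(\<lambda>j. M * (\<Sum>i\<le>n. p i (h j t - g t))) \<longlonglongrightarrow> M * (\<Sum>i\<le>n. 0)"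
        unfolding tendsto_iff_seminorms by (intro tendsto_mult_left tendsto_sum) auto
      then have "(\<lambda>j. M * (\<Sum>i\<le>n. p i (h j t - g t))) \<longlonglongrightarrow> 0" by simp
      then have "(\<lambda>j. \<phi> (h j t) - \<phi> (g t)) \<longlonglongrightarrow> 0"
        by (rule Lim_null_comparison[rotated]) (use \<phi> in auto)
      then show "(\<lambda>j. \<phi> (h j t)) \<longlonglongrightarrow> \<phi> (g t)" by (simp add: LIM_zero_iff)
    qed
  qed
  have cauchy: "\<exists>N. \<forall>j\<ge>N. \<forall>l\<ge>N. (\<integral>t. \<bar>\<phi> (h j t) - \<phi> (h l t)\<bar> \<partial>?L) < \<epsilon>" if \<epsilon>: "\<epsilon> > 0" for \<epsilon>
  proof -
    have "((\<lambda>z. M * (\<Sum>i\<le>n. (\<lambda>(j, l). \<integral>t. p i (h j t - h l t) \<partial>?L) z)) \<longlongrightarrow> M * (\<Sum>i\<le>n. 0))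
        (sequentially \<times>\<^sub>F sequentially)"
      using app unfolding step_approximation_def by (intro tendsto_mult_left tendsto_sum) blast
    then have "eventually (\<lambda>z. M * (\<Sum>i\<le>n. (\<lambda>(j, l). \<integral>t. p i (h j t - h l t) \<partial>?L) z) < \<epsilon>)
        (sequentially \<times>\<^sub>F sequentially)"
      using \<epsilon> by (intro order_tendstoD(2)) auto
    then obtain N where N: "\<And>j l. j \<ge> N \<Longrightarrow> l \<ge> N \<Longrightarrow> M * (\<Sum>i\<le>n. \<integral>t. p i (h j t - h l t) \<partial>?L) < \<epsilon>"
      unfolding eventually_prod_sequentially by auto
    have "(\<integral>t. \<bar>\<phi> (h j t) - \<phi> (h l t)\<bar> \<partial>?L) < \<epsilon>" if "j \<ge> N" "l \<ge> N" for j l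
    proof -
      have "(\<integral>t. \<bar>\<phi> (h j t) - \<phi> (h l t)\<bar> \<partial>?L) \<le> (\<integral>t. M * (\<Sum>i\<le>n. p i (h j t - h l t)) \<partial>?L)"
        by (intro integral_mono integrable_abs Bochner_Integration.integrable_diff int \<phi>
              integrable_mult_right Bochner_Integration.integrable_sum intp)
      also have "\<dots> = M * (\<Sum>i\<le>n. \<integral>t. p i (h j t - h l t) \<partial>?L)"
        using intp by simp
      finally show ?thesis using N[OF that] by simp
    qed
    then show ?thesis by blast
  qed
  have cm: "complete_measure ?L" by (rule complete_measure_lebesgue_on) simp
  show "integrable ?L (\<lambda>t. \<phi> (g t))"
    "(\<lambda>j. \<integral>t. \<phi> (h j t) \<partial>?L) \<longlonglongrightarrow> (\<integral>t. \<phi> (g t) \<partial>?L)"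
    by (rule L1_cauchy_AE_limit[OF cm int ae cauchy]; assumption)+
qed

lemma integrable_seminorm:
  assumes "frechet_integrable p a b g" shows "integrable (lebesgue_on {a..b}) (\<lambda>t. p s (g t))"
proof -
  obtain h where h: "step_approximation p a b g h" using assms by (auto simp: frechet_integrable_def)
  show ?thesis
  proof (rule step_approximation_lipschitz(1)[OF h])
    have "p s z \<le> (\<Sum>i\<le>s. p i z)" for z by (intro member_le_sum) (auto simp: p_nonneg)
    then show "\<bar>p s x - p s y\<bar> \<le> 1 * (\<Sum>i\<le>s. p i (x - y))" for x y
      using p_abs_diff[of s x y] by (metis mult_1 order_trans)
  qed
qed

lemma seminorm_step_integral_le:
  assumes "step_function a b h"
  shows "p s (step_integral a b h) \<le> (\<integral>t. p s (h t) \<partial>lebesgue_on {a..b})"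
proof -
  have fin: "finite (h ` {a..b})" using assms by (simp add: step_function_def)
  have "p s (step_integral a b h)
      \<le> (\<Sum>c\<in>h ` {a..b} - {0}. p s (measure lebesgue {t\<in>{a..b}. h t = c} *\<^sub>R c))"
    unfolding step_integral_def by (rule p_sum)
  also have "\<dots> = (\<Sum>c\<in>h ` {a..b} - {0}. measure lebesgue {t\<in>{a..b}. h t = c} * p s c)"
    by (simp add: p_scaleR)
  also have "\<dots> = (\<Sum>c\<in>h ` {a..b}. measure lebesgue {t\<in>{a..b}. h t = c} * p s c)"
    using fin by (intro sum.mono_neutral_left) (auto simp: p_zero)
  finally show ?thesis using step_function_lebesgue_integral(2)[OF assms, of "p s"] by simp
qed

end

context frechet_basis
begin

lemma coord_lipschitz: "\<exists>n M. \<forall>x y. \<bar>coord e k x - coord e k y\<bar> \<le> M * (\<Sum>i\<le>n. p i (x - y))"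
  using coord_continuous[of k] unfolding coord_diff[symmetric] by blast

lemma coord_step_integral:
  assumes "step_function a b h"
  shows "coord e k (step_integral a b h) = (\<integral>t. coord e k (h t) \<partial>lebesgue_on {a..b})"
proof -
  have fin: "finite (h ` {a..b})" using assms by (simp add: step_function_def)
  have "coord e k (step_integral a b h) =
     (\<Sum>c\<in>h ` {a..b} - {0}. measure lebesgue {t\<in>{a..b}. h t = c} * coord e k c)"
    unfolding step_integral_def by (simp add: coord_sum)
  also have "\<dots> = (\<Sum>c\<in>h ` {a..b}. measure lebesgue {t\<in>{a..b}. h t = c} * coord e k c)"
    using fin by (intro sum.mono_neutral_left) auto
  finally show ?thesis using step_function_lebesgue_integral(2)[OF assms, of "coord e k"] by simp
qed

text \<open>
  The integral of a step function is a sum over its values, so its additivity would require common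
  refinements; comparing the coordinates, which are Lebesgue integrals, avoids them.
\<close>
lemma step_integral_diff:
  fixes h h' :: "real \<Rightarrow> 'a"
  assumes "step_function a b h" "step_function a b h'"
  shows "step_integral a b h - step_integral a b h' = step_integral a b (\<lambda>t. h t - h' t)"
  by (rule coord_eqI)
    (simp add: assms coord_step_integral step_function_diff step_function_lebesgue_integral)

lemma step_integrals_converge:
  assumes app: "step_approximation p a b g h"
  shows "\<exists>I. (\<lambda>n. step_integral a b (h n)) \<longlonglongrightarrow> I"
proof (rule complete, intro allI impI)
  fix s and \<epsilon> :: real assume "\<epsilon> > 0"
  have h: "step_function a b (h j)" for j using app by (simp add: step_approximation_def)
  have "((\<lambda>(j, l). \<integral>t. p s (h j t - h l t) \<partial>lebesgue_on {a..b}) \<longlongrightarrow> 0)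
      (sequentially \<times>\<^sub>F sequentially)" using app by (simp add: step_approximation_def)
  then have "eventually (\<lambda>z. (\<lambda>(j, l). \<integral>t. p s (h j t - h l t) \<partial>lebesgue_on {a..b}) z < \<epsilon>)
      (sequentially \<times>\<^sub>F sequentially)"
    using \<open>\<epsilon> > 0\<close> by (rule order_tendstoD)
  then obtain N where N: "\<And>j l. j \<ge> N \<Longrightarrow> l \<ge> N \<Longrightarrow> (\<integral>t. p s (h j t - h l t) \<partial>lebesgue_on {a..b}) < \<epsilon>"
    unfolding eventually_prod_sequentially by auto
  have "p s (step_integral a b (h m) - step_integral a b (h n)) < \<epsilon>" if "m \<ge> N" "n \<ge> N" for m n
    unfolding step_integral_diff[OF h h]
    using seminorm_step_integral_le[OF step_function_diff[OF h h]] N[OF that] by (rule le_less_trans)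
  then show "\<exists>N. \<forall>m\<ge>N. \<forall>n\<ge>N. p s (step_integral a b (h m) - step_integral a b (h n)) < \<epsilon>" by blast
qed

lemma coord_limit_step_integrals:
  assumes app: "step_approximation p a b g h" and I: "(\<lambda>n. step_integral a b (h n)) \<longlonglongrightarrow> I"
  shows "coord e k I = (\<integral>t. coord e k (g t) \<partial>lebesgue_on {a..b})"
proof -
  obtain n M where "\<And>x y. \<bar>coord e k x - coord e k y\<bar> \<le> M * (\<Sum>i\<le>n. p i (x - y))"
    using coord_lipschitz by blast
  from step_approximation_lipschitz(2)[OF app this]
  have "(\<lambda>j. coord e k (step_integral a b (h j))) \<longlonglongrightarrow> (\<integral>t. coord e k (g t) \<partial>lebesgue_on {a..b})"
    using app by (simp add: coord_step_integral step_approximation_def)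
  with tendsto_coord[OF I] show ?thesis by (rule LIMSEQ_unique)
qed

text \<open>
  Since the coordinates separate points, this determines the integral and shows its independence of
  the approximating step functions.
\<close>
lemma coord_frechet_integral:
  assumes "frechet_integrable p a b g"
  shows "coord e k (frechet_integral p a b g) = (\<integral>t. coord e k (g t) \<partial>lebesgue_on {a..b})"
proof -
  have "\<exists>!I. \<exists>h. step_approximation p a b g h \<and> (\<lambda>n. step_integral a b (h n)) \<longlonglongrightarrow> I"
  proof (rule ex_ex1I)
    show "\<exists>I h. step_approximation p a b g h \<and> (\<lambda>n. step_integral a b (h n)) \<longlonglongrightarrow> I"
      using assms step_integrals_converge unfolding frechet_integrable_def by blast
    show "I = J"
      if "\<exists>h. step_approximation p a b g h \<and> (\<lambda>n. step_integral a b (h n)) \<longlonglongrightarrow> I"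
        and "\<exists>h. step_approximation p a b g h \<and> (\<lambda>n. step_integral a b (h n)) \<longlonglongrightarrow> J" for I J
      using that coord_limit_step_integrals by (intro coord_eqI) metis
  qed
  from theI'[OF this] show ?thesis
    unfolding frechet_integral_def[symmetric] using coord_limit_step_integrals by blast
qed

lemma integrable_coord:
  assumes "frechet_integrable p a b g" shows "integrable (lebesgue_on {a..b}) (\<lambda>t. coord e k (g t))"
proof -
  obtain h where h: "step_approximation p a b g h" using assms by (auto simp: frechet_integrable_def)
  obtain n M where "\<And>x y. \<bar>coord e k x - coord e k y\<bar> \<le> M * (\<Sum>i\<le>n. p i (x - y))"
    using coord_lipschitz by blast
  from step_approximation_lipschitz(1)[OF h this] show ?thesis .
qed

lemma solid_integrable_bound:
  assumes "frechet_integrable p a b g"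
  shows "\<exists>W. integrable (lebesgue_on {a..b}) W \<and> (\<forall>t. solid s (g t) \<le> W t)"
proof -
  obtain n M where M: "\<And>x. solid s x \<le> M * (\<Sum>i\<le>n. p i x)" using solid_continuous by blast
  have "integrable (lebesgue_on {a..b}) (\<lambda>t. M * (\<Sum>i\<le>n. p i (g t)))"
    using integrable_seminorm[OF assms] by simp
  then show ?thesis using M by blast
qed

text \<open>
  Approximate each coordinate by simple functions of at most twice its size, and let the \<open>n\<close>-th step
  function use the \<open>n\<close>-th approximations of the first \<open>n\<close> coordinates. These converge pointwise because
  they stay in an order interval, and in mean because three times the solid seminorms of \<open>g\<close>
  dominate the error.
\<close>
lemma frechet_integrableI:
  assumes meas: "\<And>k. (\<lambda>t. coord e k (g t)) \<in> borel_measurable (lebesgue_on {a..b})"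
    and bound: "\<And>s. \<exists>W. integrable (lebesgue_on {a..b}) W \<and> (\<forall>t\<in>{a..b}. solid s (g t) \<le> W t)"
  shows "frechet_integrable p a b g"
proof -
  let ?L = "lebesgue_on {a..b}"
  have "\<exists>F. (\<forall>i. simple_function ?L (F i)) \<and> (\<forall>t\<in>{a..b}. (\<lambda>i. F i t) \<longlonglongrightarrow> coord e k (g t)) \<and>
      (\<forall>i. \<forall>t\<in>{a..b}. \<bar>F i t\<bar> \<le> 2 * \<bar>coord e k (g t)\<bar>)" for k
    using borel_measurable_implies_sequence_metric[OF meas[of k], of 0] by (simp add: dist_real_def)
  then obtain c where c: "\<And>k i. simple_function ?L (c k i)"
      "\<And>k t. t \<in> {a..b} \<Longrightarrow> (\<lambda>i. c k i t) \<longlonglongrightarrow> coord e k (g t)"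
      "\<And>k i t. t \<in> {a..b} \<Longrightarrow> \<bar>c k i t\<bar> \<le> 2 * \<bar>coord e k (g t)\<bar>" by metis
  define h where "h n t = (\<Sum>k<n. c k n t *\<^sub>R e k)" for n t
  have "simple_function ?L (\<lambda>t. \<Sum>k<m. c k n t *\<^sub>R e k)" for m n
  proof (induction m)
    case (Suc m)
    have "simple_function ?L (\<lambda>t. (\<Sum>k<m. c k n t *\<^sub>R e k) + c m n t *\<^sub>R e m)"
      by (rule simple_function_compose2[OF Suc simple_function_compose1[OF c(1)]])
    then show ?case by simp
  qed simp
  then have step: "step_function a b (h n)" for n
    unfolding step_function_iff_simple_function h_def .
  have coord_h: "coord e k (h n t) = (if k < n then c k n t else 0)" for k n t
    by (simp add: h_def coord_finite_combination)
  have dom: "\<bar>coord e k (h n t - g t)\<bar> \<le> \<bar>coord e k (3 *\<^sub>R g t)\<bar>" if "t \<in> {a..b}" for k n t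
    using c(3)[OF that, of k n] by (auto simp: coord_h abs_mult)
  have lim: "(\<lambda>n. h n t) \<longlonglongrightarrow> g t" if t: "t \<in> {a..b}" for t
  proof -
    have "(\<lambda>n. h n t - g t) \<longlonglongrightarrow> 0"
    proof (rule dominated_tendsto_0)
      show "eventually (\<lambda>n. \<forall>k. \<bar>coord e k (h n t - g t)\<bar> \<le> \<bar>coord e k (3 *\<^sub>R g t)\<bar>) sequentially"
        using dom[OF t] by auto
      have "(\<lambda>n. coord e k (h n t)) \<longlonglongrightarrow> coord e k (g t)" for k
        by (rule Lim_transform_eventually[OF c(2)[OF t]])
          (auto simp: coord_h eventually_sequentially intro!: exI[of _ "Suc k"])
      then show "(\<lambda>n. coord e k (h n t - g t)) \<longlonglongrightarrow> 0" for k
        unfolding coord_diff by (rule LIM_zero)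
    qed
    then show ?thesis unfolding tendsto_iff_seminorms by simp
  qed
  \<comment> \<open>The seminorm of a step function is measurable, so the error is written as a limit of such seminorms.\<close>
  have mps: "(\<lambda>t. p s (h n t - g t)) \<in> borel_measurable ?L" for s n
  proof (rule borel_measurable_LIMSEQ_metric)
    show "(\<lambda>t. p s (h n t - h m t)) \<in> borel_measurable ?L" for m
      using step_function_lebesgue_integral(1)[OF step_function_diff[OF step step], of "p s"] by auto
    show "(\<lambda>m. p s (h n t - h m t)) \<longlonglongrightarrow> p s (h n t - g t)" if "t \<in> space ?L" for t
      using that by (intro tendsto_seminorm frechet_tendsto_diff tendsto_const lim) simp
  qed
  have intp: "integrable ?L (\<lambda>t. p s (h n t - g t))"
    and limp: "(\<lambda>n. \<integral>t. p s (h n t - g t) \<partial>?L) \<longlonglongrightarrow> 0" for s n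
  proof -
    obtain W where W: "integrable ?L W" "\<And>t. t \<in> {a..b} \<Longrightarrow> solid s (g t) \<le> W t"
      using bound[of s] by blast
    have W3: "integrable ?L (\<lambda>t. 3 * W t)" using W(1) by simp
    have le: "p s (h n t - g t) \<le> 3 * W t" if "t \<in> {a..b}" for n t
    proof -
      have "p s (h n t - g t) \<le> solid s (h n t - g t)" by (rule seminorm_le_solid)
      also have "\<dots> \<le> solid s (3 *\<^sub>R g t)" by (rule solid_mono[OF dom[OF that]])
      also have "\<dots> \<le> 3 * W t" using W(2)[OF that] by (simp add: seminorm_scaleR[OF seminorm_solid])
      finally show ?thesis .
    qed
    have AEl: "AE t in ?L. (\<lambda>n. p s (h n t - g t)) \<longlonglongrightarrow> 0"
      using lim by (intro AE_I2) (simp add: tendsto_iff_seminorms)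
    have AEb: "AE t in ?L. norm (p s (h n t - g t)) \<le> 3 * W t" for n
      using le by (intro AE_I2) (simp add: p_nonneg)
    show "integrable ?L (\<lambda>t. p s (h n t - g t))"
      by (rule Bochner_Integration.integrable_bound[OF W3 mps])
        (use le p_nonneg in \<open>auto intro!: AE_I2 intro: order_trans[OF _ abs_ge_self]\<close>)
    have "(\<lambda>n. \<integral>t. p s (h n t - g t) \<partial>?L) \<longlonglongrightarrow> (\<integral>t. 0 \<partial>?L)"
      by (rule integral_dominated_convergence[OF _ mps W3 AEl AEb]) simp
    then show "(\<lambda>n. \<integral>t. p s (h n t - g t) \<partial>?L) \<longlonglongrightarrow> 0" by simp
  qed
  have "((\<lambda>(n, m). \<integral>t. p s (h n t - h m t) \<partial>?L) \<longlongrightarrow> 0) (sequentially \<times>\<^sub>F sequentially)" for s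
  proof (rule Lim_null_comparison)
    let ?D = "\<lambda>n. \<integral>t. p s (h n t - g t) \<partial>?L"
    have "((\<lambda>z. ?D (fst z) + ?D (snd z)) \<longlongrightarrow> 0 + 0) (sequentially \<times>\<^sub>F sequentially)"
      by (intro tendsto_add filterlim_compose[OF limp] filterlim_fst filterlim_snd)
    then show "((\<lambda>z. ?D (fst z) + ?D (snd z)) \<longlongrightarrow> 0) (sequentially \<times>\<^sub>F sequentially)" by simp
    have "norm (\<integral>t. p s (h n t - h m t) \<partial>?L) \<le> ?D n + ?D m" for n m
    proof -
      have "(\<integral>t. p s (h n t - h m t) \<partial>?L) \<le> (\<integral>t. p s (h n t - g t) + p s (h m t - g t) \<partial>?L)"
      proof (rule integral_mono)
        show "integrable ?L (\<lambda>t. p s (h n t - h m t))"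
          by (rule step_function_lebesgue_integral(1)[OF step_function_diff[OF step step]])
        show "integrable ?L (\<lambda>t. p s (h n t - g t) + p s (h m t - g t))"
          by (intro Bochner_Integration.integrable_add intp)
        show "p s (h n t - h m t) \<le> p s (h n t - g t) + p s (h m t - g t)" for t
          using p_triangle[of s "h n t" "h m t" "g t"] p_minus_commute[of s "g t" "h m t"] by simp
      qed
      also have "\<dots> = ?D n + ?D m" by (intro Bochner_Integration.integral_add intp)
      finally show ?thesis using Bochner_Integration.integral_nonneg[of ?L "\<lambda>t. p s (h n t - h m t)"]
        by (simp add: p_nonneg)
    qed
    then show "eventually (\<lambda>z. norm (case z of (n, m) \<Rightarrow> \<integral>t. p s (h n t - h m t) \<partial>?L)
        \<le> ?D (fst z) + ?D (snd z)) (sequentially \<times>\<^sub>F sequentially)"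
      by (intro always_eventually) auto
  qed
  then have "step_approximation p a b g h"
    unfolding step_approximation_def using step lim by (auto intro!: AE_I2)
  then show ?thesis unfolding frechet_integrable_def by blast
qed

text \<open>
  Between \<open>l\<close> and \<open>C\<close>, the distance to \<open>C\<close> is dominated coordinatewise by \<open>C - l\<close>, so the solid
  seminorms give an integrable majorant.
\<close>
lemma frechet_integrable_between:
  assumes meas: "\<And>k. (\<lambda>t. coord e k (g t)) \<in> borel_measurable (lebesgue_on {a..b})"
    and l: "frechet_integrable p a b l"
    and bnd: "\<And>t. t \<in> {a..b} \<Longrightarrow> coord_le e (l t) (g t)" "\<And>t. t \<in> {a..b} \<Longrightarrow> coord_le e (g t) C"
  shows "frechet_integrable p a b g"
proof (rule frechet_integrableI[OF meas])
  fix s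
  obtain W where W: "integrable (lebesgue_on {a..b}) W" "\<And>t. solid s (l t) \<le> W t"
    using solid_integrable_bound[OF l] by blast
  have "solid s (g t) \<le> 2 * solid s C + W t" if t: "t \<in> {a..b}" for t
  proof -
    have "solid s (C - g t) \<le> solid s (C - l t)"
    proof (rule solid_mono)
      fix k
      have "coord e k (l t) \<le> coord e k (g t)" "coord e k (g t) \<le> coord e k C"
        using bnd[OF t] by (auto simp: coord_le_def)
      then show "\<bar>coord e k (C - g t)\<bar> \<le> \<bar>coord e k (C - l t)\<bar>" by simp
    qed
    then show ?thesis
      using seminorm_diff[OF seminorm_solid, of s C "C - g t"]
        seminorm_diff[OF seminorm_solid, of s C "l t"] W(2)[of t] by simp
  qed
  moreover have "integrable (lebesgue_on {a..b}) (\<lambda>t. 2 * solid s C + W t)"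
    using W(1) by (intro Bochner_Integration.integrable_add integrable_const_lebesgue_on)
  ultimately show "\<exists>W. integrable (lebesgue_on {a..b}) W \<and> (\<forall>t\<in>{a..b}. solid s (g t) \<le> W t)" by blast
qed

lemma frechet_integrable_subinterval:
  assumes g: "frechet_integrable p a b g" and sub: "{c..d} \<subseteq> {a..b}"
  shows "frechet_integrable p c d g"
proof (rule frechet_integrableI)
  have sub_int: "integrable (lebesgue_on {c..d}) w" if "integrable (lebesgue_on {a..b}) w" for w :: "real \<Rightarrow> real"
    using that set_integrable_subset[of lebesgue "{a..b}" w "{c..d}"] sub
    by (simp add: integrable_restrict_space set_integrable_def)
  show "(\<lambda>t. coord e k (g t)) \<in> borel_measurable (lebesgue_on {c..d})" for k
    using sub_int[OF integrable_coord[OF g]] by auto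
  show "\<exists>W. integrable (lebesgue_on {c..d}) W \<and> (\<forall>t\<in>{c..d}. solid s (g t) \<le> W t)" for s
    using solid_integrable_bound[OF g, of s] sub_int by blast
qed

lemma frechet_integrable_modulus:
  assumes g: "frechet_integrable p a b g"
  shows "\<exists>G. frechet_integrable p a b G \<and> (\<forall>k t. coord e k (G t) = \<bar>coord e k (g t)\<bar>)"
proof -
  have "\<forall>t. \<exists>y. \<forall>k. coord e k y = \<bar>coord e k (g t)\<bar>"
    by (auto intro!: dominated_element_exists)
  then obtain G where G: "\<And>t k. coord e k (G t) = \<bar>coord e k (g t)\<bar>" by metis
  have "frechet_integrable p a b G"
  proof (rule frechet_integrableI)
    show "(\<lambda>t. coord e k (G t)) \<in> borel_measurable (lebesgue_on {a..b})" for k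
      using integrable_abs[OF integrable_coord[OF g]] by (auto simp: G)
    have "solid s (G t) \<le> solid s (g t)" for s t by (rule solid_mono) (simp add: G)
    then show "\<exists>W. integrable (lebesgue_on {a..b}) W \<and> (\<forall>t\<in>{a..b}. solid s (G t) \<le> W t)" for s
      using solid_integrable_bound[OF g, of s] by (meson order_trans)
  qed
  with G show ?thesis by blast
qed

end

section \<open>Indefinite integrals and paths\<close>

context frechet_basis
begin

lemma coord_le_refl [simp]: "coord_le e x x"
  by (simp add: coord_le_def)

lemma coord_le_trans: "coord_le e x y \<Longrightarrow> coord_le e y z \<Longrightarrow> coord_le e x z"
  unfolding coord_le_def using order_trans by blast

lemma coord_le_antisym: "coord_le e x y \<Longrightarrow> coord_le e y x \<Longrightarrow> x = y"
  unfolding coord_le_def by (rule coord_eqI) (simp add: antisym)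

lemma coord_integrable_on:
  assumes "frechet_integrable p a b g" shows "(\<lambda>t. coord e k (g t)) integrable_on {a..b}"
  using integrable_coord[OF assms] by (rule integrable_on_lebesgue_on) simp

lemma abs_coord_integrable_on:
  assumes "frechet_integrable p a b g" shows "(\<lambda>t. \<bar>coord e k (g t)\<bar>) integrable_on {a..b}"
  using integrable_abs[OF integrable_coord[OF assms]] by (rule integrable_on_lebesgue_on) simp

lemma coord_indefinite_integral:
  assumes "frechet_integrable p 0 T g" "t \<in> {0..T}"
  shows "coord e k (frechet_integral p 0 t g) = integral {0..t} (\<lambda>\<xi>. coord e k (g \<xi>))"
proof -
  have g: "frechet_integrable p 0 t g"
    by (rule frechet_integrable_subinterval[OF assms(1)]) (use assms(2) in auto)
  show ?thesis
    unfolding coord_frechet_integral[OF g]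
    by (rule lebesgue_integral_eq_integral[OF integrable_coord[OF g]]) simp
qed

lemma continuous_on_coord_indefinite_integral:
  assumes "frechet_integrable p 0 T g"
  shows "continuous_on {0..T} (\<lambda>t. coord e k (frechet_integral p 0 t g))"
  using indefinite_integral_continuous_1[OF coord_integrable_on[OF assms]]
  by (rule continuous_on_eq) (simp add: coord_indefinite_integral[OF assms])

text \<open>
  The integral of the modulus of \<open>g\<close> over the whole interval serves as the bound.
\<close>
lemma indefinite_integral_dominated:
  assumes g: "frechet_integrable p 0 T g"
  shows "\<exists>B. \<forall>t\<in>{0..T}. \<forall>k. \<bar>coord e k (frechet_integral p 0 t g)\<bar> \<le> coord e k B"
proof -
  obtain G where G: "frechet_integrable p 0 T G" "\<And>k t. coord e k (G t) = \<bar>coord e k (g t)\<bar>"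
    using frechet_integrable_modulus[OF g] by blast
  have "\<bar>coord e k (frechet_integral p 0 t g)\<bar> \<le> coord e k (frechet_integral p 0 T G)"
    if t: "t \<in> {0..T}" for t k
  proof -
    have sub: "frechet_integrable p 0 t g"
      by (rule frechet_integrable_subinterval[OF g]) (use t in auto)
    have "\<bar>integral {0..t} (\<lambda>\<xi>. coord e k (g \<xi>))\<bar> \<le> integral {0..t} (\<lambda>\<xi>. \<bar>coord e k (g \<xi>)\<bar>)"
      using integral_norm_bound_integral[OF coord_integrable_on[OF sub] abs_coord_integrable_on[OF sub]]
      by simp
    also have "\<dots> \<le> integral {0..T} (\<lambda>\<xi>. \<bar>coord e k (g \<xi>)\<bar>)"
      using t by (intro integral_subset_le abs_coord_integrable_on sub g) auto
    also have "\<dots> = coord e k (frechet_integral p 0 T G)"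
      using t by (subst coord_indefinite_integral[OF G(1)]) (auto simp: G(2))
    finally show ?thesis by (simp add: coord_indefinite_integral[OF g t])
  qed
  then show ?thesis by blast
qed

text \<open>
  All values lie in one order interval, so the continuity of the coordinates suffices.
\<close>
lemma continuous_on_indefinite_integral:
  assumes g: "frechet_integrable p 0 T g"
  shows "continuous_on {0..T} (\<lambda>t. x + frechet_integral p 0 t g)"
proof (rule continuous_on_sequentiallyI)
  fix \<tau> :: "nat \<Rightarrow> real" and t
  assume \<tau>: "\<forall>n. \<tau> n \<in> {0..T}" "t \<in> {0..T}" "\<tau> \<longlonglongrightarrow> t"
  obtain B where B: "\<And>t k. t \<in> {0..T} \<Longrightarrow> \<bar>coord e k (frechet_integral p 0 t g)\<bar> \<le> coord e k B"
    using indefinite_integral_dominated[OF g] by blast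
  have bnd: "coord_le e (- B) (frechet_integral p 0 t g)" "coord_le e (frechet_integral p 0 t g) B"
    if "t \<in> {0..T}" for t
    using B[OF that] by (auto simp: coord_le_def abs_le_iff minus_le_iff)
  have "(\<lambda>n. frechet_integral p 0 (\<tau> n) g) \<longlonglongrightarrow> frechet_integral p 0 t g"
  proof (rule order_bounded_tendsto)
    show "eventually (\<lambda>n. coord_le e (- B) (frechet_integral p 0 (\<tau> n) g)
        \<and> coord_le e (frechet_integral p 0 (\<tau> n) g) B) sequentially"
      using bnd \<tau>(1) by (intro always_eventually) blast
    show "(\<lambda>n. coord e k (frechet_integral p 0 (\<tau> n) g)) \<longlonglongrightarrow> coord e k (frechet_integral p 0 t g)" for k
      using continuous_on_coord_indefinite_integral[OF g, of k] \<tau>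
      unfolding continuous_on_sequentially comp_def by blast
  qed (use bnd \<tau> in auto)
  then show "(\<lambda>n. x + frechet_integral p 0 (\<tau> n) g) \<longlonglongrightarrow> x + frechet_integral p 0 t g"
    by (intro frechet_tendsto_add) auto
qed

lemma indefinite_integral_mono:
  assumes g: "frechet_integrable p 0 T g" and h: "frechet_integrable p 0 T h" and t: "t \<in> {0..T}"
    and le: "\<And>\<xi>. \<xi> \<in> {0..T} \<Longrightarrow> coord_le e (g \<xi>) (h \<xi>)"
  shows "coord_le e (frechet_integral p 0 t g) (frechet_integral p 0 t h)"
proof -
  have sub: "frechet_integrable p 0 t g" "frechet_integrable p 0 t h"
    using frechet_integrable_subinterval[OF g, of 0 t] frechet_integrable_subinterval[OF h, of 0 t] t by auto
  show ?thesis
    unfolding coord_le_def coord_indefinite_integral[OF g t] coord_indefinite_integral[OF h t]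
    using le t by (intro allI integral_le coord_integrable_on sub) (auto simp: coord_le_def)
qed

text \<open>
  The paths along which the superposition with \<open>f\<close> will turn out to be integrable: continuity is
  required of the coordinates only, a property that suprema of solutions can be seen to inherit.
\<close>
definition tame_path :: "real \<Rightarrow> (real \<Rightarrow> 'a) \<Rightarrow> bool" where
  "tame_path T u \<longleftrightarrow> (\<forall>k. continuous_on {0..T} (\<lambda>t. coord e k (u t))) \<and>
     (\<exists>a b. \<forall>t\<in>{0..T}. coord_le e a (u t) \<and> coord_le e (u t) b)"

lemma tame_path_indefinite_integral:
  assumes g: "frechet_integrable p 0 T g"
  shows "tame_path T (\<lambda>t. x + frechet_integral p 0 t g)"
proof -
  obtain B where B: "\<And>t k. t \<in> {0..T} \<Longrightarrow> \<bar>coord e k (frechet_integral p 0 t g)\<bar> \<le> coord e k B"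
    using indefinite_integral_dominated[OF g] by blast
  have "coord_le e (x - B) (x + frechet_integral p 0 t g)" "coord_le e (x + frechet_integral p 0 t g) (x + B)"
    if "t \<in> {0..T}" for t
    using B[OF that] by (auto simp: coord_le_def abs_le_iff minus_le_iff)
  moreover have "continuous_on {0..T} (\<lambda>t. coord e k (x + frechet_integral p 0 t g))" for k
    by (auto intro!: continuous_intros continuous_on_coord_indefinite_integral g)
  ultimately show ?thesis unfolding tame_path_def by blast
qed

text \<open>
  An increasing sequence below \<open>x\<close> stays in an order interval, so coordinatewise convergence is enough
  to apply left continuity.
\<close>
lemma left_continuous_order_bounded:
  assumes cont: "left_continuous e \<phi>"
    and inc: "\<And>n. coord_le e (X n) (X (Suc n))" and le: "\<And>n. coord_le e (X n) x"
    and lim: "\<And>k. (\<lambda>n. coord e k (X n)) \<longlonglongrightarrow> coord e k x"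
  shows "(\<lambda>n. \<phi> (X n)) \<longlonglongrightarrow> \<phi> x"
proof -
  have ge: "coord_le e (X 0) (X n)" for n
    by (induction n) (auto intro: coord_le_trans inc)
  have "X \<longlonglongrightarrow> x"
    by (rule order_bounded_tendsto[of "X 0" X x]) (use ge le lim in auto)
  then show ?thesis using cont inc unfolding left_continuous_def by blast
qed

end

section \<open>The monotone initial value problem\<close>

locale monotone_ivp = frechet_basis +
  fixes T :: real and x0 C :: 'a and f :: "real \<Rightarrow> 'a \<Rightarrow> 'a"
  assumes T_pos: "T > 0"
    and left_cont: "t \<in> {0..T} \<Longrightarrow> left_continuous e (\<lambda>x. coord e k (f t x))"
    and f_integrable: "frechet_integrable p 0 T (\<lambda>t. f t x)"
    and f_le_C: "t \<in> {0..T} \<Longrightarrow> coord_le e (f t x) C"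
    and f_mono: "t \<in> {0..T} \<Longrightarrow> coord_le e x y \<Longrightarrow> coord_le e (f t x) (f t y)"
begin

text \<open>
  \<open>X n t\<close> is the coordinatewise infimum of \<open>u\<close> over the dyadic interval of length \<open>2\<^sup>-\<^sup>n\<close> that contains
  \<open>t\<close>; it exists in the space because \<open>u\<close> is order bounded. The dyadic intervals are nested and the
  coordinates of \<open>u\<close> are continuous, so \<open>X n t\<close> increases to \<open>u t\<close>. As a step path, \<open>X n\<close> has a
  measurable superposition with \<open>f\<close>, and left continuity passes measurability on to the limit.
\<close>
lemma superposition_integrable:
  assumes u: "tame_path T u" shows "frechet_integrable p 0 T (\<lambda>t. f t (u t))"
proof -
  obtain a b where ab: "\<And>t. t \<in> {0..T} \<Longrightarrow> coord_le e a (u t)" "\<And>t. t \<in> {0..T} \<Longrightarrow> coord_le e (u t) b"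
    using u unfolding tame_path_def by blast
  have ak: "coord e k a \<le> coord e k (u t)" and bk: "coord e k (u t) \<le> coord e k b"
    if "t \<in> {0..T}" for t k
    using ab[OF that] by (auto simp: coord_le_def)
  have cont: "continuous_on {0..T} (\<lambda>t. coord e k (u t))" for k using u by (simp add: tame_path_def)
  define cell where "cell n i = {s\<in>{0..T}. \<lfloor>2 ^ n * s\<rfloor> = i}" for n :: nat and i :: int
  have bdd: "bdd_below ((\<lambda>s. coord e k (u s)) ` cell n i)" for k n i
    using ak by (intro bdd_belowI[of _ "coord e k a"]) (auto simp: cell_def)
  have "\<exists>y. \<forall>k. coord e k y = (if cell n i = {} then coord e k a else INF s\<in>cell n i. coord e k (u s))" for n i
  proof (rule between_element_exists)
    fix k
    have "coord e k a \<le> coord e k b" using ak[of 0 k] bk[of 0 k] T_pos by simp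
    moreover have "coord e k a \<le> (INF s\<in>cell n i. coord e k (u s))"
        "(INF s\<in>cell n i. coord e k (u s)) \<le> coord e k b" if ne: "cell n i \<noteq> {}"
    proof -
      show "coord e k a \<le> (INF s\<in>cell n i. coord e k (u s))"
        by (rule cINF_greatest[OF ne]) (use ak in \<open>auto simp: cell_def\<close>)
      obtain s where s: "s \<in> cell n i" using ne by blast
      then show "(INF s\<in>cell n i. coord e k (u s)) \<le> coord e k b"
        using bk by (intro cINF_lower2[OF bdd s]) (auto simp: cell_def)
    qed
    ultimately show "coord e k a \<le> (if cell n i = {} then coord e k a else INF s\<in>cell n i. coord e k (u s))"
      "(if cell n i = {} then coord e k a else INF s\<in>cell n i. coord e k (u s)) \<le> coord e k b" by auto
  qed
  then obtain y where y: "\<And>n i k. coord e k (y n i) =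
      (if cell n i = {} then coord e k a else INF s\<in>cell n i. coord e k (u s))" by metis
  \<comment> \<open>For empty cells, which contain no \<open>t\<close>, \<open>y\<close> has the default value \<open>a\<close>.\<close>
  define X where "X n t = y n \<lfloor>2 ^ n * t\<rfloor>" for n and t :: real
  have own: "t \<in> cell n \<lfloor>2 ^ n * t\<rfloor>" if "t \<in> {0..T}" for t n using that by (simp add: cell_def)
  have X: "coord e k (X n t) = (INF s\<in>cell n \<lfloor>2 ^ n * t\<rfloor>. coord e k (u s))" if "t \<in> {0..T}" for t n k
    using own[OF that, of n] by (auto simp: X_def y)
  have X_le: "coord_le e (X n t) (u t)" if "t \<in> {0..T}" for n t
    unfolding coord_le_def using X[OF that] by (auto intro!: cINF_lower bdd own that)
  have nested: "cell (Suc n) \<lfloor>2 ^ Suc n * t\<rfloor> \<subseteq> cell n \<lfloor>2 ^ n * t\<rfloor>" for n and t :: real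
  proof -
    have half: "\<lfloor>x\<rfloor> = \<lfloor>2 * x\<rfloor> div 2" for x :: real
      using floor_divide_real_eq_div[of 2 "2 * x"] by simp
    have "\<lfloor>2 ^ n * s\<rfloor> = \<lfloor>2 ^ n * t\<rfloor>" if "\<lfloor>2 ^ Suc n * s\<rfloor> = \<lfloor>2 ^ Suc n * t\<rfloor>" for s :: real
    proof -
      have "\<lfloor>2 * (2 ^ n * s)\<rfloor> = \<lfloor>2 * (2 ^ n * t)\<rfloor>" using that by (simp add: mult.assoc)
      then show ?thesis using half[of "2 ^ n * s"] half[of "2 ^ n * t"] by metis
    qed
    then show ?thesis unfolding cell_def by blast
  qed
  have X_inc: "coord_le e (X n t) (X (Suc n) t)" if t: "t \<in> {0..T}" for n t
    unfolding coord_le_def X[OF t]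
    using own[OF t, of "Suc n"] by (intro allI cINF_superset_mono bdd nested) auto
  have X_lim: "(\<lambda>n. coord e k (X n t)) \<longlonglongrightarrow> coord e k (u t)" if t: "t \<in> {0..T}" for t k
  proof (rule LIMSEQ_I)
    fix r :: real assume r: "r > 0"
    then obtain \<delta> where \<delta>: "\<delta> > 0"
        "\<And>s. s \<in> {0..T} \<Longrightarrow> dist s t < \<delta> \<Longrightarrow> dist (coord e k (u s)) (coord e k (u t)) < r / 2"
      using cont[of k] t unfolding continuous_on_iff by (meson half_gt_zero)
    obtain N where N: "(1/2)^N < \<delta>" using \<delta>(1) real_arch_pow_inv[of \<delta> "1/2"] by auto
    have "norm (coord e k (X n t) - coord e k (u t)) < r" if n: "n \<ge> N" for n
    proof -
      have "coord e k (u t) - r / 2 \<le> coord e k (X n t)"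
        unfolding X[OF t]
      proof (rule cINF_greatest)
        fix s assume s: "s \<in> cell n \<lfloor>2 ^ n * t\<rfloor>"
        then have "\<bar>2 ^ n * s - 2 ^ n * t\<bar> < 1" by (auto simp: cell_def) linarith
        then have "2 ^ n * \<bar>s - t\<bar> < 1" by (simp add: abs_mult flip: right_diff_distrib)
        then have "\<bar>s - t\<bar> < (1/2)^n" by (simp add: field_simps power_divide)
        also have "\<dots> \<le> (1/2)^N" using n by (intro power_decreasing) auto
        finally have "dist s t < \<delta>" using N by (simp add: dist_real_def)
        moreover have "s \<in> {0..T}" using s by (simp add: cell_def)
        ultimately have "\<bar>coord e k (u s) - coord e k (u t)\<bar> < r / 2"
          using \<delta>(2)[of s] by (simp add: dist_real_def)
        then show "coord e k (u t) - r / 2 \<le> coord e k (u s)" by linarith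
      qed (use own[OF t] in auto)
      moreover have "coord e k (X n t) \<le> coord e k (u t)" using X_le[OF t] by (simp add: coord_le_def)
      ultimately show ?thesis using r by simp
    qed
    then show "\<exists>N. \<forall>n\<ge>N. norm (coord e k (X n t) - coord e k (u t)) < r" by blast
  qed
  show ?thesis
  proof (rule frechet_integrable_between[OF _ f_integrable[of a]])
    fix k
    show "(\<lambda>t. coord e k (f t (u t))) \<in> borel_measurable (lebesgue_on {0..T})"
    proof (rule borel_measurable_LIMSEQ_metric)
      fix n
      show "(\<lambda>t. coord e k (f t (X n t))) \<in> borel_measurable (lebesgue_on {0..T})"
        unfolding X_def
      proof (rule measurable_compose_countable)
        show "(\<lambda>t. coord e k (f t (y n i))) \<in> borel_measurable (lebesgue_on {0..T})" for i
          using integrable_coord[OF f_integrable] by auto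
        have "(\<lambda>t. 2 ^ n * t) \<in> borel_measurable (lebesgue_on {0..T})"
          using id_borel_measurable_lebesgue_on[of "{0..T}"] by (simp add: id_def)
        then show "(\<lambda>t. \<lfloor>2 ^ n * t\<rfloor>) \<in> measurable (lebesgue_on {0..T}) (count_space UNIV)"
          by (rule measurable_compose) (rule measurable_real_floor)
      qed
    next
      fix t assume "t \<in> space (lebesgue_on {0..T})"
      then have t: "t \<in> {0..T}" by simp
      show "(\<lambda>n. coord e k (f t (X n t))) \<longlonglongrightarrow> coord e k (f t (u t))"
        by (rule left_continuous_order_bounded[OF left_cont[OF t]]) (use X_inc X_le X_lim t in auto)
    qed
  qed (use ab f_le_C f_mono in auto)
qed

definition picard :: "(real \<Rightarrow> 'a) \<Rightarrow> real \<Rightarrow> 'a" where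
  "picard u t = x0 + frechet_integral p 0 t (\<lambda>\<xi>. f \<xi> (u \<xi>))"

lemma ivp_solution_iff_picard:
  "ivp_solution p T f x0 x \<longleftrightarrow> continuous_on {0..T} x \<and>
     frechet_integrable p 0 T (\<lambda>t. f t (x t)) \<and> (\<forall>t\<in>{0..T}. x t = picard x t)"
  unfolding ivp_solution_def picard_def ..

lemma coord_picard:
  assumes "frechet_integrable p 0 T (\<lambda>\<xi>. f \<xi> (u \<xi>))" "t \<in> {0..T}"
  shows "coord e k (picard u t) = coord e k x0 + integral {0..t} (\<lambda>\<xi>. coord e k (f \<xi> (u \<xi>)))"
  using coord_indefinite_integral[OF assms] by (simp add: picard_def)

lemma tame_path_picard:
  assumes "frechet_integrable p 0 T (\<lambda>\<xi>. f \<xi> (u \<xi>))" shows "tame_path T (picard u)"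
  unfolding picard_def by (rule tame_path_indefinite_integral[OF assms])

lemma continuous_on_picard:
  assumes "frechet_integrable p 0 T (\<lambda>\<xi>. f \<xi> (u \<xi>))" shows "continuous_on {0..T} (picard u)"
  unfolding picard_def by (rule continuous_on_indefinite_integral[OF assms])

lemma picard_mono:
  assumes "tame_path T u" "tame_path T v" and le: "\<And>\<xi>. \<xi> \<in> {0..T} \<Longrightarrow> coord_le e (u \<xi>) (v \<xi>)"
    and t: "t \<in> {0..T}"
  shows "coord_le e (picard u t) (picard v t)"
  using indefinite_integral_mono[OF superposition_integrable[OF assms(1)] superposition_integrable[OF assms(2)] t]
    f_mono le by (simp add: picard_def coord_le_def)

text \<open>
  The bound is \<open>x0 + T \<bar>C\<bar>\<close>. The modulus is taken since \<open>t C\<close> is not below \<open>T C\<close> in coordinates where \<open>C\<close>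
  is negative.
\<close>
lemma picard_upper_bound:
  "\<exists>b. \<forall>u. frechet_integrable p 0 T (\<lambda>\<xi>. f \<xi> (u \<xi>)) \<longrightarrow> (\<forall>t\<in>{0..T}. coord_le e (picard u t) b)"
proof -
  obtain D where D: "\<And>k. coord e k D = \<bar>coord e k C\<bar>"
    using dominated_element_exists[of "\<lambda>k. \<bar>coord e k C\<bar>" C] by auto
  have "coord_le e (picard u t) (x0 + T *\<^sub>R D)"
    if u: "frechet_integrable p 0 T (\<lambda>\<xi>. f \<xi> (u \<xi>))" and t: "t \<in> {0..T}" for u t
    unfolding coord_le_def
  proof
    fix k
    have "integral {0..t} (\<lambda>\<xi>. coord e k (f \<xi> (u \<xi>))) \<le> integral {0..t} (\<lambda>\<xi>. \<bar>coord e k C\<bar>)"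
    proof (rule integral_le)
      show "(\<lambda>\<xi>. coord e k (f \<xi> (u \<xi>))) integrable_on {0..t}"
        by (intro coord_integrable_on frechet_integrable_subinterval[OF u]) (use t in auto)
      show "coord e k (f \<xi> (u \<xi>)) \<le> \<bar>coord e k C\<bar>" if "\<xi> \<in> {0..t}" for \<xi>
        using f_le_C[of \<xi> "u \<xi>"] that t by (force simp: coord_le_def intro: order_trans[OF _ abs_ge_self])
    qed auto
    also have "\<dots> = t * \<bar>coord e k C\<bar>" using t by simp
    also have "\<dots> \<le> T * \<bar>coord e k C\<bar>" using t by (intro mult_right_mono) auto
    finally show "coord e k (picard u t) \<le> coord e k (x0 + T *\<^sub>R D)"
      by (simp add: coord_picard[OF u t] D)
  qed
  then show ?thesis by blast
qed

text \<open>
  The iterates \<open>U n\<close> of the integral operator increase and are bounded by \<open>picard_upper_bound\<close>, so they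
  have a coordinatewise supremum \<open>w\<close>. Left continuity gives \<open>f(t, U n t) \<rightarrow> f(t, w t)\<close>, and dominated
  convergence in each coordinate passes to the limit in \<open>U (Suc n) = picard (U n)\<close>. The limit \<open>w\<close> is not yet
  known to be tame; integrability of \<open>f(t, w t)\<close> comes from its position between \<open>f(t, u t)\<close> and \<open>C\<close>.
\<close>
lemma solution_above_subsolution:
  assumes u: "tame_path T u" and sub: "\<And>t. t \<in> {0..T} \<Longrightarrow> coord_le e (u t) (picard u t)"
  shows "\<exists>w. ivp_solution p T f x0 w \<and> (\<forall>t\<in>{0..T}. coord_le e (u t) (w t))"
proof -
  define U where "U n = (picard ^^ n) u" for n
  have U0: "U 0 = u" and US: "U (Suc n) = picard (U n)" for n by (auto simp: U_def)
  have tame: "tame_path T (U n)" for n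
    by (induction n) (auto simp: U0 US u intro: tame_path_picard superposition_integrable)
  have intU: "frechet_integrable p 0 T (\<lambda>t. f t (U n t))" for n
    by (rule superposition_integrable[OF tame])
  have inc: "coord_le e (U n t) (U (Suc n) t)" if "t \<in> {0..T}" for n t
    using that
  proof (induction n arbitrary: t)
    case 0
    then show ?case using sub by (simp add: U0 US)
  next
    case (Suc n)
    show ?case
      using picard_mono[OF tame[of n] tame[of "Suc n"] Suc.IH Suc.prems] by (simp add: US)
  qed
  obtain b where "\<And>v t. frechet_integrable p 0 T (\<lambda>\<xi>. f \<xi> (v \<xi>)) \<Longrightarrow> t \<in> {0..T} \<Longrightarrow> coord_le e (picard v t) b"
    using picard_upper_bound by blast
  from this[OF intU] have bnd: "coord_le e (U n t) b" if "t \<in> {0..T}" for n t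
    using inc[OF that, of n] that by (auto simp: US intro: coord_le_trans)
  have lower: "coord_le e (u t) (U n t)" if "t \<in> {0..T}" for n t
    by (induction n) (use that inc in \<open>auto simp: U0 intro: coord_le_trans\<close>)
  have bdd: "bdd_above (range (\<lambda>n. coord e k (U n t)))" if "t \<in> {0..T}" for k t
    using bnd[OF that] by (intro bdd_aboveI[of _ "coord e k b"]) (auto simp: coord_le_def)
  have "\<exists>w. t \<in> {0..T} \<longrightarrow> (\<forall>k. coord e k w = (SUP n. coord e k (U n t)))" for t
  proof (cases "t \<in> {0..T}")
    case True
    have "\<exists>w. \<forall>k. coord e k w = (SUP n. coord e k (U n t))"
    proof (rule between_element_exists)
      show "coord e k (u t) \<le> (SUP n. coord e k (U n t))" for k
        using cSUP_upper[OF _ bdd[OF True], of 0] by (simp add: U0)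
      show "(SUP n. coord e k (U n t)) \<le> coord e k b" for k
        using bnd[OF True] by (intro cSUP_least) (auto simp: coord_le_def)
    qed
    then show ?thesis by blast
  qed blast
  then obtain w where w: "\<And>t k. t \<in> {0..T} \<Longrightarrow> coord e k (w t) = (SUP n. coord e k (U n t))" by metis
  have lim: "(\<lambda>n. coord e k (U n t)) \<longlonglongrightarrow> coord e k (w t)" if t: "t \<in> {0..T}" for t k
    unfolding w[OF t]
    using inc[OF t] by (intro LIMSEQ_incseq_SUP bdd[OF t] incseq_SucI) (auto simp: coord_le_def)
  have U_le_w: "coord_le e (U n t) (w t)" if t: "t \<in> {0..T}" for n t
    unfolding coord_le_def w[OF t] by (auto intro: cSUP_upper bdd[OF t])
  have limf: "(\<lambda>n. coord e k (f t (U n t))) \<longlonglongrightarrow> coord e k (f t (w t))" if t: "t \<in> {0..T}" for t k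
    by (rule left_continuous_order_bounded[OF left_cont[OF t]]) (use inc U_le_w lim t in auto)
  have u_le_w: "coord_le e (u t) (w t)" if "t \<in> {0..T}" for t using U_le_w[OF that, of 0] by (simp add: U0)
  have intw: "frechet_integrable p 0 T (\<lambda>t. f t (w t))"
  proof (rule frechet_integrable_between[OF _ superposition_integrable[OF u]])
    show "(\<lambda>t. coord e k (f t (w t))) \<in> borel_measurable (lebesgue_on {0..T})" for k
    proof (rule borel_measurable_LIMSEQ_metric[where f = "\<lambda>n t. coord e k (f t (U n t))"])
      show "(\<lambda>t. coord e k (f t (U n t))) \<in> borel_measurable (lebesgue_on {0..T})" for n
        using integrable_coord[OF intU] by auto
    qed (use limf in auto)
  qed (use u_le_w f_le_C f_mono in auto)
  have fix_w: "w t = picard w t" if t: "t \<in> {0..T}" for t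
  proof (rule coord_eqI)
    fix k
    let ?L = "lebesgue_on {0..t}"
    have sub: "frechet_integrable p 0 t g" if "frechet_integrable p 0 T g" for g
      by (rule frechet_integrable_subinterval[OF that]) (use t in auto)
    have "(\<lambda>n. \<integral>\<xi>. coord e k (f \<xi> (U n \<xi>)) \<partial>?L) \<longlonglongrightarrow> (\<integral>\<xi>. coord e k (f \<xi> (w \<xi>)) \<partial>?L)"
    proof (rule integral_dominated_convergence[where w = "\<lambda>\<xi>. \<bar>coord e k (f \<xi> (u \<xi>))\<bar> + \<bar>coord e k C\<bar>"])
      show "(\<lambda>\<xi>. coord e k (f \<xi> (w \<xi>))) \<in> borel_measurable ?L"
        "(\<lambda>\<xi>. coord e k (f \<xi> (U n \<xi>))) \<in> borel_measurable ?L" for n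
        using integrable_coord[OF sub[OF intw]] integrable_coord[OF sub[OF intU]] by auto
      show "integrable ?L (\<lambda>\<xi>. \<bar>coord e k (f \<xi> (u \<xi>))\<bar> + \<bar>coord e k C\<bar>)"
        using integrable_coord[OF sub[OF superposition_integrable[OF u]]]
        by (intro Bochner_Integration.integrable_add integrable_abs integrable_const_lebesgue_on)
      show "AE \<xi> in ?L. (\<lambda>n. coord e k (f \<xi> (U n \<xi>))) \<longlonglongrightarrow> coord e k (f \<xi> (w \<xi>))"
        using limf t by (intro AE_I2) auto
      show "AE \<xi> in ?L. norm (coord e k (f \<xi> (U n \<xi>))) \<le> \<bar>coord e k (f \<xi> (u \<xi>))\<bar> + \<bar>coord e k C\<bar>" for n
      proof (rule AE_I2)
        fix \<xi> assume "\<xi> \<in> space ?L"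
        then have \<xi>: "\<xi> \<in> {0..T}" using t by auto
        have "coord e k (f \<xi> (u \<xi>)) \<le> coord e k (f \<xi> (U n \<xi>))" "coord e k (f \<xi> (U n \<xi>)) \<le> coord e k C"
          using f_mono[OF \<xi> lower[OF \<xi>]] f_le_C[OF \<xi>] by (auto simp: coord_le_def)
        then show "norm (coord e k (f \<xi> (U n \<xi>))) \<le> \<bar>coord e k (f \<xi> (u \<xi>))\<bar> + \<bar>coord e k C\<bar>" by simp
      qed
    qed
    then have "(\<lambda>n. coord e k x0 + coord e k (frechet_integral p 0 t (\<lambda>\<xi>. f \<xi> (U n \<xi>))))
        \<longlonglongrightarrow> coord e k x0 + coord e k (frechet_integral p 0 t (\<lambda>\<xi>. f \<xi> (w \<xi>)))"
      unfolding coord_frechet_integral[OF sub[OF intU]] coord_frechet_integral[OF sub[OF intw]]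
      by (intro tendsto_intros)
    then have "(\<lambda>n. coord e k (U (Suc n) t)) \<longlonglongrightarrow> coord e k (picard w t)"
      by (simp add: US picard_def)
    with LIMSEQ_Suc[OF lim[OF t]] show "coord e k (w t) = coord e k (picard w t)"
      by (rule LIMSEQ_unique)
  qed
  have "continuous_on {0..T} w"
    using continuous_on_picard[OF intw] by (rule continuous_on_eq) (simp add: fix_w[symmetric])
  then have "ivp_solution p T f x0 w"
    unfolding ivp_solution_iff_picard using intw fix_w by blast
  then show ?thesis using u_le_w by blast
qed

lemma solution_tame:
  assumes "ivp_solution p T f x0 v" shows "tame_path T v"
proof -
  have v: "frechet_integrable p 0 T (\<lambda>\<xi>. f \<xi> (v \<xi>))" "\<And>t. t \<in> {0..T} \<Longrightarrow> v t = picard v t"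
    using assms by (auto simp: ivp_solution_iff_picard)
  have "continuous_on {0..T} (\<lambda>t. coord e k (v t)) \<longleftrightarrow> continuous_on {0..T} (\<lambda>t. coord e k (picard v t))" for k
    using v(2) by (intro continuous_on_cong) auto
  then show ?thesis using tame_path_picard[OF v(1)] v(2) by (auto simp: tame_path_def)
qed

lemma solution_upper_bound:
  "\<exists>b. \<forall>v. ivp_solution p T f x0 v \<longrightarrow> (\<forall>t\<in>{0..T}. coord_le e (v t) b)"
  using picard_upper_bound unfolding ivp_solution_iff_picard by metis

text \<open>
  The coordinatewise maximum of two solutions is a subsolution by monotonicity.
\<close>
lemma solutions_directed:
  assumes v: "ivp_solution p T f x0 v" and v': "ivp_solution p T f x0 v'"
  shows "\<exists>w. ivp_solution p T f x0 w \<and> (\<forall>t\<in>{0..T}. coord_le e (v t) (w t) \<and> coord_le e (v' t) (w t))"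
proof -
  have "\<exists>m. \<forall>k. coord e k m = max (coord e k (v t)) (coord e k (v' t))" for t
  proof -
    obtain y where "\<And>k. coord e k y = \<bar>coord e k (v' t - v t)\<bar>"
      using dominated_element_exists[of "\<lambda>k. \<bar>coord e k (v' t - v t)\<bar>" "v' t - v t"] by auto
    then show ?thesis by (intro between_element_exists[of "v t" _ "v t + y"]) auto
  qed
  then obtain m where m: "\<And>t k. coord e k (m t) = max (coord e k (v t)) (coord e k (v' t))" by metis
  have le: "coord_le e (v t) (m t)" "coord_le e (v' t) (m t)" for t by (auto simp: coord_le_def m)
  have tm: "tame_path T m"
  proof -
    obtain a where a: "\<And>t. t \<in> {0..T} \<Longrightarrow> coord_le e a (v t)"
      using solution_tame[OF v] unfolding tame_path_def by blast
    obtain b where b: "\<And>v t. ivp_solution p T f x0 v \<Longrightarrow> t \<in> {0..T} \<Longrightarrow> coord_le e (v t) b"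
      using solution_upper_bound by blast
    have "coord_le e a (m t)" "coord_le e (m t) b" if "t \<in> {0..T}" for t
      using coord_le_trans[OF a[OF that] le(1)] b[OF v that] b[OF v' that] by (auto simp: coord_le_def m)
    moreover have "continuous_on {0..T} (\<lambda>t. coord e k (m t))" for k
      unfolding m using solution_tame[OF v] solution_tame[OF v']
      by (intro continuous_on_max) (auto simp: tame_path_def)
    ultimately show ?thesis unfolding tame_path_def by blast
  qed
  have "coord_le e (m t) (picard m t)" if t: "t \<in> {0..T}" for t
  proof -
    have "coord_le e (picard v t) (picard m t)" "coord_le e (picard v' t) (picard m t)"
      by (rule picard_mono[OF solution_tame[OF v] tm le(1) t], rule picard_mono[OF solution_tame[OF v'] tm le(2) t])
    moreover have "picard v t = v t" "picard v' t = v' t"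
      using v v' t by (auto simp: ivp_solution_iff_picard)
    ultimately show ?thesis by (auto simp: coord_le_def m)
  qed
  from solution_above_subsolution[OF tm this] show ?thesis
    using le coord_le_trans by metis
qed

text \<open>
  For a solution \<open>w\<close> above \<open>v\<close> the integrand lies between \<open>f(\<xi>, v(\<xi>))\<close> and \<open>C\<close>. The bound depends on
  \<open>v\<close> alone, so the solutions above \<open>v\<close> are equicontinuous in each coordinate.
\<close>
lemma solution_increment_le:
  assumes v: "ivp_solution p T f x0 v" and w: "ivp_solution p T f x0 w"
    and le: "\<And>t. t \<in> {0..T} \<Longrightarrow> coord_le e (v t) (w t)"
    and st: "s \<in> {0..T}" "t \<in> {0..T}"
  shows "\<bar>coord e k (w t) - coord e k (w s)\<bar> \<le>
    \<bar>integral {0..t} (\<lambda>\<xi>. \<bar>coord e k (f \<xi> (v \<xi>))\<bar> + \<bar>coord e k C\<bar>)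
      - integral {0..s} (\<lambda>\<xi>. \<bar>coord e k (f \<xi> (v \<xi>))\<bar> + \<bar>coord e k C\<bar>)\<bar>"
  using st
proof (induction s t rule: linorder_wlog)
  case (le s t)
  let ?h = "\<lambda>\<xi>. \<bar>coord e k (f \<xi> (v \<xi>))\<bar> + \<bar>coord e k C\<bar>"
  let ?F = "\<lambda>\<xi>. coord e k (f \<xi> (w \<xi>))"
  have iv: "frechet_integrable p 0 T (\<lambda>\<xi>. f \<xi> (v \<xi>))" and iw: "frechet_integrable p 0 T (\<lambda>\<xi>. f \<xi> (w \<xi>))"
    using v w by (auto simp: ivp_solution_iff_picard)
  have hT: "?h integrable_on {0..T}"
    by (rule integrable_add[OF abs_coord_integrable_on[OF iv] integrable_const_ivl])
  have sub: "g integrable_on {c..t}" if "g integrable_on {0..T}" "0 \<le> c" for g :: "real \<Rightarrow> real" and c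
    using integrable_on_subinterval[OF that(1), of c t] that(2) le by auto
  have "coord e k (w t) - coord e k (w s) = integral {0..t} ?F - integral {0..s} ?F"
    using w le by (simp add: ivp_solution_iff_picard coord_picard[OF iw])
  also have "\<dots> = integral {s..t} ?F"
    using Henstock_Kurzweil_Integration.integral_combine[of 0 s t ?F] sub[OF coord_integrable_on[OF iw]] le by simp
  finally have 1: "coord e k (w t) - coord e k (w s) = integral {s..t} ?F" .
  have 2: "integral {0..t} ?h - integral {0..s} ?h = integral {s..t} ?h"
    using Henstock_Kurzweil_Integration.integral_combine[of 0 s t ?h] sub[OF hT] le by simp
  have "\<bar>integral {s..t} ?F\<bar> \<le> integral {s..t} ?h"
  proof -
    have "norm (?F \<xi>) \<le> ?h \<xi>" if "\<xi> \<in> {s..t}" for \<xi>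
    proof -
      have \<xi>: "\<xi> \<in> {0..T}" using that le by auto
      have "coord e k (f \<xi> (v \<xi>)) \<le> ?F \<xi>" "?F \<xi> \<le> coord e k C"
        using f_mono[OF \<xi> \<open>\<And>t. t \<in> {0..T} \<Longrightarrow> coord_le e (v t) (w t)\<close>[OF \<xi>]] f_le_C[OF \<xi>]
        by (auto simp: coord_le_def)
      then show ?thesis by simp
    qed
    then show ?thesis
      using integral_norm_bound_integral[OF sub[OF coord_integrable_on[OF iw]] sub[OF hT], of s k] le by simp
  qed
  then show ?case unfolding 1 2 by simp
next
  case (sym s t)
  then show ?case by (simp add: abs_minus_commute)
qed

text \<open>
  The supremum is tame because the solutions above \<open>v0\<close> are equicontinuous in each coordinate and
  determine it, by directedness. It is a subsolution because every solution is below it; the solution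
  above it belongs to \<open>Q\<close> and hence coincides with it.
\<close>
theorem supremum_of_solutions:
  assumes v0: "ivp_solution p T f x0 v0"
  defines "Q \<equiv> {v. ivp_solution p T f x0 v}"
  shows "\<forall>t\<in>{0..T}. coord_sup_well_defined e {v t | v. v \<in> Q}"
    and "ivp_solution p T f x0 (\<lambda>t. coord_sup e {v t | v. v \<in> Q})"
proof -
  have Q: "v \<in> Q \<longleftrightarrow> ivp_solution p T f x0 v" for v by (simp add: Q_def)
  have v0Q: "v0 \<in> Q" using v0 by (simp add: Q)
  obtain b where b: "\<And>v t. v \<in> Q \<Longrightarrow> t \<in> {0..T} \<Longrightarrow> coord_le e (v t) b"
    using solution_upper_bound unfolding Q by blast
  define V where "V t = {v t | v. v \<in> Q}" for t
  define S where "S t k = (SUP x\<in>V t. coord e k x)" for t k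
  have ne: "V t \<noteq> {}" for t using v0Q by (auto simp: V_def)
  have bdd: "bdd_above (coord e k ` V t)" if "t \<in> {0..T}" for t k
    using b[OF _ that] by (intro bdd_aboveI[of _ "coord e k b"]) (auto simp: V_def coord_le_def)
  have up: "coord e k (v t) \<le> S t k" if "v \<in> Q" "t \<in> {0..T}" for v t k
    unfolding S_def using that(1) by (intro cSUP_upper bdd[OF that(2)]) (auto simp: V_def)
  have least: "S t k \<le> B" if "\<And>v. v \<in> Q \<Longrightarrow> coord e k (v t) \<le> B" for t k B
    unfolding S_def by (rule cSUP_least[OF ne]) (use that in \<open>auto simp: V_def\<close>)
  have "\<exists>y. t \<in> {0..T} \<longrightarrow> (\<forall>k. coord e k y = S t k)" for t
  proof (cases "t \<in> {0..T}")
    case True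
    have "\<exists>y. \<forall>k. coord e k y = S t k"
      by (rule between_element_exists[of "v0 t" _ b])
        (use up[OF v0Q True] b True least in \<open>auto simp: coord_le_def\<close>)
    then show ?thesis by blast
  qed blast
  then obtain y where y: "\<And>t k. t \<in> {0..T} \<Longrightarrow> coord e k (y t) = S t k" by metis
  have sums: "(\<lambda>k. S t k *\<^sub>R e k) sums y t" if "t \<in> {0..T}" for t
    using coord_sums[of "y t"] by (simp add: y[OF that])
  define xb where "xb t = coord_sup e (V t)" for t
  have xb: "xb t = y t" if "t \<in> {0..T}" for t
    using sums_unique[OF sums[OF that]] by (simp add: xb_def coord_sup_def S_def)
  have xbk: "coord e k (xb t) = S t k" if "t \<in> {0..T}" for t k using xb[OF that] y[OF that] by simp
  show "\<forall>t\<in>{0..T}. coord_sup_well_defined e {v t | v. v \<in> Q}"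
    unfolding V_def[symmetric] coord_sup_well_defined_def
  proof (intro ballI conjI allI)
    fix t assume t: "t \<in> {0..T}"
    show "V t \<noteq> {}" by (rule ne)
    show "bdd_above (coord e k ` V t)" for k by (rule bdd[OF t])
    show "summable (\<lambda>k. (SUP x\<in>V t. coord e k x) *\<^sub>R e k)"
      using sums_summable[OF sums[OF t]] by (simp add: S_def)
  qed
  have Q_le: "coord_le e (v t) (xb t)" if "v \<in> Q" "t \<in> {0..T}" for v t
    unfolding coord_le_def using up[OF that] by (simp add: xbk[OF that(2)])
  have tame: "tame_path T xb"
  proof -
    have "continuous_on {0..T} (\<lambda>t. coord e k (xb t))" for k
    proof -
      let ?h = "\<lambda>\<xi>. \<bar>coord e k (f \<xi> (v0 \<xi>))\<bar> + \<bar>coord e k C\<bar>"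
      let ?A = "\<lambda>t. integral {0..t} ?h"
      have "frechet_integrable p 0 T (\<lambda>\<xi>. f \<xi> (v0 \<xi>))" using v0 by (simp add: ivp_solution_iff_picard)
      then have "?h integrable_on {0..T}"
        by (intro integrable_add[OF abs_coord_integrable_on integrable_const_ivl])
      then have contA: "continuous_on {0..T} ?A" by (rule indefinite_integral_continuous_1)
      \<comment> \<open>It suffices to compare with solutions \<open>w\<close> above \<open>v0\<close>, to which \<open>solution_increment_le\<close> applies.\<close>
      have step: "S t k \<le> S s k + \<bar>?A t - ?A s\<bar>" if st: "s \<in> {0..T}" "t \<in> {0..T}" for s t
      proof (rule least)
        fix v assume "v \<in> Q"
        then obtain w where w: "w \<in> Q" "\<And>t. t \<in> {0..T} \<Longrightarrow> coord_le e (v t) (w t)"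
            "\<And>t. t \<in> {0..T} \<Longrightarrow> coord_le e (v0 t) (w t)"
          using solutions_directed[of v v0] v0 unfolding Q by blast
        have "coord e k (v t) \<le> coord e k (w t)" using w(2)[OF st(2)] by (simp add: coord_le_def)
        also have "\<dots> \<le> coord e k (w s) + \<bar>?A t - ?A s\<bar>"
          using solution_increment_le[OF v0 _ w(3) st, of k] w(1) by (simp add: Q abs_le_iff)
        also have "\<dots> \<le> S s k + \<bar>?A t - ?A s\<bar>" using up[OF w(1) st(1)] by simp
        finally show "coord e k (v t) \<le> S s k + \<bar>?A t - ?A s\<bar>" .
      qed
      show ?thesis
      proof (rule continuous_on_sequentiallyI)
        fix \<tau> :: "nat \<Rightarrow> real" and t
        assume \<tau>: "\<forall>n. \<tau> n \<in> {0..T}" "t \<in> {0..T}" "\<tau> \<longlonglongrightarrow> t"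
        have "(\<lambda>n. ?A (\<tau> n)) \<longlonglongrightarrow> ?A t"
          using contA \<tau> unfolding continuous_on_sequentially comp_def by blast
        then have A: "(\<lambda>n. \<bar>?A (\<tau> n) - ?A t\<bar>) \<longlonglongrightarrow> 0"
          by (intro tendsto_rabs_zero LIM_zero)
        have le: "norm (S (\<tau> n) k - S t k) \<le> \<bar>?A (\<tau> n) - ?A t\<bar>" for n
          using step[OF \<tau>(2) \<tau>(1)[rule_format, of n]] step[OF \<tau>(1)[rule_format, of n] \<tau>(2)]
          unfolding real_norm_def by linarith
        have "(\<lambda>n. S (\<tau> n) k - S t k) \<longlonglongrightarrow> 0"
          by (rule Lim_null_comparison[OF always_eventually[OF allI[OF le]] A])
        then show "(\<lambda>n. coord e k (xb (\<tau> n))) \<longlonglongrightarrow> coord e k (xb t)"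
          using \<tau> by (simp add: xbk LIM_zero_iff)
      qed
    qed
    moreover obtain a where "\<And>t. t \<in> {0..T} \<Longrightarrow> coord_le e a (v0 t)"
      using solution_tame[OF v0] unfolding tame_path_def by blast
    then have "coord_le e a (xb t)" if "t \<in> {0..T}" for t
      using coord_le_trans Q_le[OF v0Q that] that by blast
    moreover have "coord_le e (xb t) b" if "t \<in> {0..T}" for t
      unfolding coord_le_def using b that by (auto simp: xbk[OF that] coord_le_def intro!: least)
    ultimately show ?thesis unfolding tame_path_def by blast
  qed
  have "coord_le e (xb t) (picard xb t)" if t: "t \<in> {0..T}" for t
    unfolding coord_le_def
  proof
    fix k
    have "coord e k (v t) \<le> coord e k (picard xb t)" if v: "v \<in> Q" for v
    proof -
      have "coord_le e (picard v t) (picard xb t)"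
        using v Q_le[OF v] t by (intro picard_mono solution_tame tame) (auto simp: Q)
      moreover have "picard v t = v t" using v t by (auto simp: Q ivp_solution_iff_picard)
      ultimately show ?thesis by (simp add: coord_le_def)
    qed
    then show "coord e k (xb t) \<le> coord e k (picard xb t)" unfolding xbk[OF t] by (rule least)
  qed
  then obtain w where w: "ivp_solution p T f x0 w" "\<And>t. t \<in> {0..T} \<Longrightarrow> coord_le e (xb t) (w t)"
    using solution_above_subsolution[OF tame] by blast
  have eq: "xb t = w t" if "t \<in> {0..T}" for t
    using w that Q_le[of w t] by (intro coord_le_antisym) (auto simp: Q)
  have "continuous_on {0..T} xb \<longleftrightarrow> continuous_on {0..T} w" by (intro continuous_on_cong) (auto simp: eq)
  moreover have "xb t = picard xb t" if t: "t \<in> {0..T}" for t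
  proof -
    have "picard w t = picard xb t"
      by (intro coord_le_antisym picard_mono tame solution_tame w t) (auto simp: eq)
    then show ?thesis using w(1) t eq[OF t] by (simp add: ivp_solution_iff_picard)
  qed
  ultimately have "ivp_solution p T f x0 xb"
    using w(1) superposition_integrable[OF tame] by (simp add: ivp_solution_iff_picard)
  then show "ivp_solution p T f x0 (\<lambda>t. coord_sup e {v t | v. v \<in> Q})"
    by (simp add: xb_def[abs_def] V_def)
qed

lemma constant_path_tame: "tame_path T (\<lambda>_. z)"
  unfolding tame_path_def by (auto intro!: exI[of _ z])

end

theorem theorem2:
  fixes p :: "nat \<Rightarrow> 'a::{real_vector, t2_space} \<Rightarrow> real"
    and e :: "nat \<Rightarrow> 'a"
    and T :: real
    and x0 :: 'a
    and f :: "real \<Rightarrow> 'a \<Rightarrow> 'a"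
    and Q :: "(real \<Rightarrow> 'a) set"
  assumes "frechet_space p"
    and "unconditional_schauder_basis e"
    and "T > 0"
    and "\<And>k t. t \<in> {0..T} \<Longrightarrow> left_continuous e (\<lambda>x. coord e k (f t x))"
    and "\<And>x. frechet_integrable p 0 T (\<lambda>t. f t x)"
    and "\<exists>C. \<forall>t\<in>{0..T}. \<forall>x. coord_le e (f t x) C"
    and "\<exists>z. \<forall>t\<in>{0..T}. coord_le e z (x0 + frechet_integral p 0 t (\<lambda>\<xi>. f \<xi> z))"
    and "\<And>x y t. t \<in> {0..T} \<Longrightarrow> coord_le e x y \<Longrightarrow> coord_le e (f t x) (f t y)"
  defines "Q \<equiv> {v. ivp_solution p T f x0 v}"
  shows "Q \<noteq> {} \<and>
    (\<forall>t\<in>{0..T}. coord_sup_well_defined e {v t | v. v \<in> Q}) \<and>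
    ivp_solution p T f x0 (\<lambda>t. coord_sup e {v t | v. v \<in> Q})"
proof -
  obtain C where C: "\<And>t x. t \<in> {0..T} \<Longrightarrow> coord_le e (f t x) C" using assms(6) by blast
  obtain z where z: "\<And>t. t \<in> {0..T} \<Longrightarrow> coord_le e z (x0 + frechet_integral p 0 t (\<lambda>\<xi>. f \<xi> z))"
    using assms(7) by blast
  interpret frechet_space p by (rule assms(1))
  interpret monotone_ivp p e T x0 C f
    by unfold_locales (use assms C in auto)
  obtain v0 where v0: "ivp_solution p T f x0 v0"
    using solution_above_subsolution[OF constant_path_tame[of z]] z by (auto simp: picard_def)
  then show ?thesis
    using supremum_of_solutions[OF v0] unfolding Q_def by blast
qed

end
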